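(* Suppose that $\mu<\Lambda^+$ and $f\in\mathcal{C}(\bar\Omega)$. Suppose that for some $u,v\in\mathcal{C}(\mathbb{R}^d)\cap L^1(\omega)$ we have $$\mathbf{I}u+\mu u\ge f\ge\mathbf{I}v+\mu v\ \text{in }\Omega,\qquad u\le v\ \text{in }\Omega^c.$$ Then $u\le v$ in $\mathbb{R}^d$.
   Context: Fix the dimension $d$, $s\in(0,1)$ and $0<\lambda\le\Lambda$. Let $\mathcal{L}_*$ be the class of all operators $$Lu(x)=\frac12\int_{\mathbb{R}^d}\bigl(u(x+y)+u(x-y)-2u(x)\bigr)\frac{k(y/|y|)}{|y|^{d+2s}}\,dy,$$ where $k\in L^\infty(S^{d-1})$, $\lambda\le k\le\Lambda$ and $k(y)=k(-y)$. Let $\mathcal{L}\subset\mathcal{L}_*$ be a nonempty subclass and $\mathbf{I}u=\sup_{L\in\mathcal{L}}Lu$. $\Omega\subset\mathbb{R}^d$ is a bounded (connected) domain with smooth boundary. $L^1(\omega)$ is the set of functions integrable with respect to the weight $\omega(y)=(1+|y|)^{-d-2s}$. All (in)equalities are in the viscosity sense: $\mathbf{I}u\ge f$ in $\Omega$ means that whenever $x_0\in\Omega$, $N\subset\Omega$ is a neighbourhood of $x_0$, and $\varphi\in\mathcal{C}^2(\bar N)$ satisfies $\varphi(x_0)=u(x_0)$ and $\varphi>u$ in $N\setminus\{x_0\}$, the function equal to $\varphi$ in $N$ and $u$ in $N^c$, say $w$, satisfies $\mathbf{I}w(x_0)\ge f(x_0)$; $\mathbf{I}u\le f$ is defined symmetrically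 (touching from below, reversed inequality). Define $$\Lambda^+=\sup\{\mu\in\mathbb{R}:\exists\,\psi\in\mathcal{C}(\mathbb{R}^d)\cap L^1(\omega),\ \psi\ge0,\ \psi>0\text{ in }\Omega,\ \mathbf{I}\psi+\mu\psi\le0\text{ in }\Omega\}.$$ *)

theory Defs
  imports "HOL-Analysis.Analysis"
begin

text \<open>
  The space \<open>\<real>\<^sup>d\<close> is a type \<open>'a::euclidean_space\<close> with \<open>d = DIM('a)\<close>.

  An element of \<open>L\<^sup>\<infinity>(S\<^sup>d\<^sup>-\<^sup>1)\<close> satisfying the two bounds and the symmetry almost everywhere has a
  Borel representative satisfying them everywhere on the sphere, and the operator below does not
  depend on the representative. Values of \<open>k\<close> off the unit sphere are irrelevant.
\<close>

definition admissible_kernel :: "real \<Rightarrow> real \<Rightarrow> ('a::euclidean_space \<Rightarrow> real) \<Rightarrow> bool" where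
  "admissible_kernel lam Lam k \<longleftrightarrow>
     k \<in> borel_measurable (restrict_space borel (sphere 0 1)) \<and>
     (\<forall>\<theta>\<in>sphere 0 1. lam \<le> k \<theta> \<and> k \<theta> \<le> Lam \<and> k (- \<theta>) = k \<theta>)"

definition stable_op ::
    "real \<Rightarrow> ('a::euclidean_space \<Rightarrow> real) \<Rightarrow> ('a \<Rightarrow> real) \<Rightarrow> 'a \<Rightarrow> real" where
  "stable_op s k u x =
     1/2 * (LINT y|lborel. (u (x + y) + u (x - y) - 2 * u x) *
                           (k (y /\<^sub>R norm y) / norm y powr (real DIM('a) + 2 * s)))"

definition stable_class ::
    "real \<Rightarrow> real \<Rightarrow> real \<Rightarrow> (('a::euclidean_space \<Rightarrow> real) \<Rightarrow> 'a \<Rightarrow> real) set" where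
  "stable_class s lam Lam = {stable_op s k | k. admissible_kernel lam Lam k}"

text \<open>
  The supremum is taken in the reals. It is used only at points near which \<open>u\<close> is \<open>C\<^sup>2\<close>, for \<open>u\<close>
  in \<open>L\<^sup>1(\<omega>)\<close>; there the integrals converge absolutely and are bounded uniformly over the whole
  class \<open>stable_class s lam Lam\<close>, so for a nonempty subclass it is a genuine supremum.
\<close>

definition sup_op ::
    "(('a \<Rightarrow> real) \<Rightarrow> 'a \<Rightarrow> real) set \<Rightarrow> ('a \<Rightarrow> real) \<Rightarrow> 'a \<Rightarrow> real" where
  "sup_op \<L> u x = (SUP L\<in>\<L>. L u x)"

definition weighted_L1 :: "real \<Rightarrow> ('a::euclidean_space \<Rightarrow> real) set" where
  "weighted_L1 s =
     {u. integrable lborel (\<lambda>y. u y * (1 + norm y) powr (- real DIM('a) - 2 * s))}"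

text \<open>
  \<open>C\<^sup>2\<close> up to the closure of an open set \<open>N\<close>: the function, its gradient and its Hessian exist in
  \<open>N\<close> and extend continuously to the closure.
\<close>

definition C2_closure :: "'a::euclidean_space set \<Rightarrow> ('a \<Rightarrow> real) \<Rightarrow> bool" where
  "C2_closure N \<phi> \<longleftrightarrow>
     (\<exists>(D :: 'a \<Rightarrow> 'a) (H :: 'a \<Rightarrow> 'a \<Rightarrow>\<^sub>L 'a).
        continuous_on (closure N) \<phi> \<and> continuous_on (closure N) D \<and> continuous_on (closure N) H \<and>
        (\<forall>x\<in>N. (\<phi> has_derivative (\<lambda>h. D x \<bullet> h)) (at x) \<and>
               (D has_derivative blinfun_apply (H x)) (at x)))"

definition visc_ge ::
    "(('a::euclidean_space \<Rightarrow> real) \<Rightarrow> 'a \<Rightarrow> real) set \<Rightarrow> 'a set \<Rightarrow> ('a \<Rightarrow> real) \<Rightarrow> ('a \<Rightarrow> real) \<Rightarrow> bool"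
  where
  "visc_ge \<L> \<Omega> u f \<longleftrightarrow>
     (\<forall>x0\<in>\<Omega>. \<forall>N \<phi>.
        open N \<and> x0 \<in> N \<and> N \<subseteq> \<Omega> \<and> C2_closure N \<phi> \<and>
        \<phi> x0 = u x0 \<and> (\<forall>x\<in>N - {x0}. \<phi> x > u x) \<longrightarrow>
        sup_op \<L> (\<lambda>x. if x \<in> N then \<phi> x else u x) x0 \<ge> f x0)"

definition visc_le ::
    "(('a::euclidean_space \<Rightarrow> real) \<Rightarrow> 'a \<Rightarrow> real) set \<Rightarrow> 'a set \<Rightarrow> ('a \<Rightarrow> real) \<Rightarrow> ('a \<Rightarrow> real) \<Rightarrow> bool"
  where
  "visc_le \<L> \<Omega> u f \<longleftrightarrow>
     (\<forall>x0\<in>\<Omega>. \<forall>N \<phi>.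
        open N \<and> x0 \<in> N \<and> N \<subseteq> \<Omega> \<and> C2_closure N \<phi> \<and>
        \<phi> x0 = u x0 \<and> (\<forall>x\<in>N - {x0}. \<phi> x < u x) \<longrightarrow>
        sup_op \<L> (\<lambda>x. if x \<in> N then \<phi> x else u x) x0 \<le> f x0)"

text \<open>
  The supremum is taken in the extended reals, so that no a priori boundedness or nonemptiness of
  the set is built in. The inequality \<open>I \<psi> + \<mu> \<psi> \<le> 0\<close> is read as \<open>I \<psi> \<le> - \<mu> \<psi>\<close>.
\<close>

definition principal_eigenvalue ::
    "real \<Rightarrow> (('a::euclidean_space \<Rightarrow> real) \<Rightarrow> 'a \<Rightarrow> real) set \<Rightarrow> 'a set \<Rightarrow> ereal" where
  "principal_eigenvalue s \<L> \<Omega> =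
     Sup {ereal \<mu> | \<mu>. \<exists>\<psi>. continuous_on UNIV \<psi> \<and> \<psi> \<in> weighted_L1 s \<and>
            (\<forall>x. \<psi> x \<ge> 0) \<and> (\<forall>x\<in>\<Omega>. \<psi> x > 0) \<and> visc_le \<L> \<Omega> \<psi> (\<lambda>x. - \<mu> * \<psi> x)}"

text \<open>
  On an open set \<open>U\<close>: differentiable \<open>k\<close> times, with all iterated partial derivatives up to
  order \<open>k\<close> continuous.
\<close>

primrec Ck_on :: "nat \<Rightarrow> 'a::euclidean_space set \<Rightarrow> ('a \<Rightarrow> real) \<Rightarrow> bool" where
  "Ck_on 0 U g \<longleftrightarrow> continuous_on U g"
| "Ck_on (Suc k) U g \<longleftrightarrow> (\<forall>x\<in>U. g differentiable at x) \<and>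
     (\<forall>b\<in>Basis. Ck_on k U (\<lambda>x. frechet_derivative g (at x) b))"

text \<open>
  Near each boundary point, \<open>\<Omega>\<close> is the sublevel set of a smooth function without critical points.
\<close>

definition smooth_boundary :: "'a::euclidean_space set \<Rightarrow> bool" where
  "smooth_boundary \<Omega> \<longleftrightarrow>
     (\<forall>p\<in>frontier \<Omega>. \<exists>U \<rho>. open U \<and> p \<in> U \<and> (\<forall>k. Ck_on k U \<rho>) \<and>
        (\<forall>x\<in>U. frechet_derivative \<rho> (at x) \<noteq> (\<lambda>h. 0)) \<and>
        \<Omega> \<inter> U = {x\<in>U. \<rho> x < 0})"

end

theory Submission
  imports Defs
begin

text \<open>
  Let \<open>w = u - v\<close>. By convexity of the supremum \<open>I\<close>, formally \<open>I w + \<mu> w \<ge> 0\<close> in \<open>\<Omega>\<close>, and \<open>w \<le> 0\<close> outside.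
  Since \<open>\<mu>\<close> lies below the principal eigenvalue, there are \<open>\<mu>' > \<mu>\<close> and a nonnegative \<open>\<psi>\<close>, positive in
  \<open>\<Omega>\<close>, with \<open>I \<psi> + \<mu>' \<psi> \<le> 0\<close>. The idea is to compare \<open>w\<close> with the multiples \<open>t \<psi>\<close> and to let \<open>t\<close>
  decrease to \<open>0\<close>. Suppose that \<open>z = w - t \<psi>\<close> is positive somewhere. It then has a positive maximum \<open>M\<close> at
  some \<open>x \<in> \<Omega>\<close>, and there
    \<open>t (\<mu>' - \<mu>) \<psi> x - \<mu> M \<le> lam * \<integral> (z (x + h) - M) / \<bar>h\<bar> powr (d + 2 s) dh \<le> 0\<close>.
  This is the inequality \<open>key\<close> in the final proof, where the integral is restricted to \<open>norm h \<ge> R\<close>. It is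
  used twice.
  
  First, if \<open>t\<close> is large, the set where \<open>z > 0\<close> lies in a set of small measure where \<open>t \<psi>\<close> is below the
  maximum of \<open>w\<close>. Most jumps \<open>h\<close> from \<open>x\<close> leave that set and lose at least \<open>M\<close>, so the integral is below
  \<open>- C M\<close> with \<open>C\<close> as large as desired (\<open>far_part_small_positivity_set\<close>, \<open>annulus_mass_large\<close>),
  which is a contradiction. Hence \<open>w \<le> T \<psi>\<close> for some \<open>T\<close>.
  
  Secondly, if \<open>w \<le> T \<psi>\<close> and \<open>t < T\<close>, then \<open>M \<le> (T - t) \<psi> x\<close>, so that
  \<open>t (\<mu>' - \<mu>) \<psi> x \<le> \<bar>\<mu>\<bar> (T - t) \<psi> x\<close>. After division by \<open>\<psi> x\<close> this fails for \<open>t = \<theta> T\<close> with some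
  \<open>\<theta> < 1\<close> depending on \<open>\<mu>\<close> and \<open>\<mu>'\<close> only. Thus \<open>w \<le> T \<psi>\<close> improves to \<open>w \<le> \<theta> T \<psi>\<close>, and iteration gives
  \<open>w \<le> 0\<close>.
  
  The inequality at the maximum has to be derived from the viscosity inequalities for \<open>u\<close>, \<open>v\<close> and \<open>\<psi>\<close>
  (\<open>comparison_at_maximum\<close>). One maximizes
  \<open>u x - v y - t \<psi> p - n (\<bar>x - y\<bar>\<^sup>2 + \<bar>x - p\<bar>\<^sup>2)\<close> and tests each function with the paraboloid that
  touches it at the maximum. Because the operators are translation invariant and their order \<open>2 s\<close> is less
  than \<open>2\<close>, no regularization of \<open>u\<close>, \<open>v\<close>, \<open>\<psi>\<close> is needed: test functions on a ball of radius \<open>r\<close>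
  contribute \<open>O(r powr (2 - 2 s))\<close>, and a common shift of the three points shows that the remaining integrand is
  nonpositive near the origin (\<open>penalized_maximum_inequality\<close>). Far away, the limit \<open>n \<rightarrow> \<infinity>\<close> is controlled,
  uniformly over the class of kernels, by the continuity of translations in the weighted \<open>L\<^sup>1\<close> space
  (\<open>tendsto_shift_weighted_L1\<close>).
\<close>

section \<open>Weights and kernels\<close>

definition weight :: "real \<Rightarrow> 'a::euclidean_space \<Rightarrow> real" where
  "weight s y = (1 + norm y) powr (- real DIM('a) - 2 * s)"

text \<open>
  With \<open>k = (\<lambda>_. 1)\<close> this is the reference kernel \<open>\<bar>h\<bar> powr (- d - 2 s)\<close>, to which every admissible
  kernel is comparable. At the origin the value is \<open>0\<close>, because division by \<open>0\<close> gives \<open>0\<close>; so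
  the value of \<open>k\<close> at \<open>0\<close>, off the unit sphere, does not enter.
\<close>
definition kern :: "real \<Rightarrow> ('a::euclidean_space \<Rightarrow> real) \<Rightarrow> 'a \<Rightarrow> real" where
  "kern s k h = k (h /\<^sub>R norm h) / norm h powr (real DIM('a) + 2 * s)"

lemma weighted_L1_iff: "u \<in> weighted_L1 s \<longleftrightarrow> integrable lborel (\<lambda>y. u y * weight s y)"
  by (simp add: weighted_L1_def weight_def)

lemma weight_pos: "0 < weight s y"
  using norm_ge_zero[of y] unfolding weight_def powr_gt_zero by linarith

lemma borel_measurable_weight [measurable]: "weight s \<in> borel_measurable borel"
  unfolding weight_def by measurable

text \<open>
  A radial power is bounded by a constant on each dyadic annulus, so its integrability reduces to
  a geometric series. Here the annuli are enlarged to the balls that contain them, which costs only a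
  constant factor and makes the volumes explicit. The lemma serves both ends: large dyadic balls for
  the weight at infinity, small ones for the second moment of the kernel at the origin.
\<close>
lemma integrable_of_summable_cballs:
  fixes g :: "'a::euclidean_space \<Rightarrow> real"
  assumes g: "g \<in> borel_measurable borel"
    and c: "\<And>j. 0 \<le> c j" and R: "\<And>j. 0 \<le> R j"
    and summ: "summable (\<lambda>j. c j * R j ^ DIM('a))"
    and bound: "\<And>h. g h \<noteq> 0 \<Longrightarrow> \<exists>j::nat. \<bar>g h\<bar> \<le> c j \<and> norm h \<le> R j"
  shows "integrable lborel g"
proof (rule integrableI_bounded)
  let ?t = "\<lambda>j h. ennreal (c j * indicator (cball (0::'a) (R j)) h)"
  have "(\<integral>\<^sup>+ h. ennreal (norm (g h)) \<partial>lborel) \<le> (\<integral>\<^sup>+ h. (\<Sum>j. ?t j h) \<partial>lborel)"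
  proof (rule nn_integral_mono)
    fix h
    show "ennreal (norm (g h)) \<le> (\<Sum>j. ?t j h)"
    proof (cases "g h = 0")
      case False
      with bound obtain j where "\<bar>g h\<bar> \<le> c j" "norm h \<le> R j" by blast
      then have "ennreal (norm (g h)) \<le> ?t j h" by (simp add: ennreal_leI)
      also have "\<dots> \<le> (\<Sum>j. ?t j h)"
        using sum_le_suminf[of "\<lambda>j. ?t j h" "{j}"] by simp
      finally show ?thesis .
    qed simp
  qed
  also have "\<dots> = (\<Sum>j. \<integral>\<^sup>+ h. ?t j h \<partial>lborel)"
    by (rule nn_integral_suminf)
      (intro measurable_compose[OF _ measurable_ennreal] borel_measurable_times
        borel_measurable_indicator borel_measurable_const, simp_all)
  also have "\<dots> = (\<Sum>j. ennreal (unit_ball_vol DIM('a) * (c j * R j ^ DIM('a))))"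
  proof (rule suminf_cong)
    fix j
    have "?t j h = ennreal (c j) * indicator (cball 0 (R j)) h" for h
      by (simp split: split_indicator)
    then have "(\<integral>\<^sup>+ h. ?t j h \<partial>lborel) = ennreal (c j) * emeasure lborel (cball (0::'a) (R j))"
      by (simp only: nn_integral_cmult_indicator[of "cball 0 (R j)"] sets_lborel borel_closed closed_cball)
    also have "\<dots> = ennreal (unit_ball_vol DIM('a) * (c j * R j ^ DIM('a)))"
      by (simp add: emeasure_cball R c ennreal_mult[symmetric] mult_ac)
    finally show "(\<integral>\<^sup>+ h. ?t j h \<partial>lborel) = \<dots>" .
  qed
  also have "\<dots> < \<infinity>"
    unfolding infinity_ennreal_def less_top[symmetric]
    by (rule ennreal_suminf_neq_top) (use summ c R in \<open>auto intro: summable_mult\<close>)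
  finally show "(\<integral>\<^sup>+ h. ennreal (norm (g h)) \<partial>lborel) < \<infinity>" .
qed (use g in simp)

lemma dyadic_scale:
  fixes y :: real
  assumes "1 \<le> y"
  obtains j :: nat where "2 ^ j \<le> y" "y < 2 ^ Suc j"
proof -
  obtain n where "y < 2 ^ n" using real_arch_pow[of 2 y] by auto
  define m where "m = (LEAST n. y < 2 ^ n)"
  have m: "y < 2 ^ m" unfolding m_def by (rule LeastI[of "\<lambda>n. y < 2 ^ n"]) fact
  with assms have "m \<noteq> 0" by (metis not_less power_0)
  then obtain j where j: "m = Suc j" using not0_implies_Suc by blast
  have "\<not> y < 2 ^ j"
    using not_less_Least[of j "\<lambda>n. y < 2 ^ n"] j unfolding m_def by simp
  with m j that[of j] show ?thesis by simp
qed

lemma integrable_weight: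
  assumes "0 < s"
  shows "integrable lborel (weight s :: 'a::euclidean_space \<Rightarrow> real)"
proof -
  let ?d = "DIM('a)"
  have eq: "(2 ^ j) powr (- real ?d - 2 * s) * (2 ^ Suc j) ^ ?d = 2 ^ ?d * (2 powr (- 2 * s)) ^ j" for j :: nat
  proof -
    have "(2 ^ j) powr (- real ?d - 2 * s) * (2 ^ j) ^ ?d = ((2::real) powr (- 2 * s)) ^ j"
      by (simp add: powr_realpow[symmetric] powr_powr powr_add[symmetric] algebra_simps)
    then show ?thesis by (simp add: power_mult_distrib)
  qed
  show ?thesis
  proof (rule integrable_of_summable_cballs[where c = "\<lambda>j. (2 ^ j) powr (- real ?d - 2 * s)" and R = "\<lambda>j. 2 ^ Suc j"])
    show "summable (\<lambda>j. (2 ^ j) powr (- real ?d - 2 * s) * (2 ^ Suc j) ^ ?d :: real)"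
      unfolding eq using assms by (intro summable_mult summable_geometric) (simp add: powr_less_one)
  next
    fix h :: 'a
    obtain j where j: "2 ^ j \<le> 1 + norm h" "1 + norm h < 2 ^ Suc j"
      using dyadic_scale[of "1 + norm h"] by auto
    have "(1 + norm h) powr (- real ?d - 2 * s) \<le> (2 ^ j) powr (- real ?d - 2 * s)"
      using j assms by (intro powr_mono2') auto
    then show "\<exists>j. \<bar>weight s h\<bar> \<le> (2 ^ j) powr (- real ?d - 2 * s) \<and> norm h \<le> 2 ^ Suc j"
      using j by (intro exI[of _ j]) (auto simp: weight_def)
  qed auto
qed

lemma integrable_near_moment_one:
  fixes r :: real
  assumes s: "0 < s" "s < 1" and r: "0 < r"
  shows "integrable lborel (\<lambda>h::'a::euclidean_space. indicator (ball 0 r) h * ((norm h)\<^sup>2 * kern s (\<lambda>_. 1) h))"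
proof -
  let ?d = "DIM('a)" and ?p = "real DIM('a) + 2 * s"
  define c where "c = (\<lambda>j::nat. (r / 2 ^ j)\<^sup>2 * (r / 2 ^ Suc j) powr (- ?p))"
  have eq: "c j * (r / 2 ^ j) ^ ?d = (2 powr ?p * r powr (2 - 2 * s)) * ((1/2) powr (2 - 2 * s)) ^ j" for j
  proof -
    define t where "t = r / 2 ^ j"
    have t: "t > 0" using r by (simp add: t_def)
    have "c j * t ^ ?d = t\<^sup>2 * (t / 2) powr (- ?p) * t ^ ?d"
      by (simp add: c_def t_def mult.commute)
    also have "(t / 2) powr (- ?p) = 2 powr ?p * t powr (- ?p)"
    proof -
      have "(t / 2) powr (- q) = 2 powr q * t powr (- q)" for q
        using powr_divide[of t 2 "- q"] powr_minus[of 2 q] t by (simp only: divide_inverse inverse_inverse_eq mult.commute[of "t powr _"])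
      then show ?thesis .
    qed
    also have "t\<^sup>2 * (2 powr ?p * t powr (- ?p)) * t ^ ?d = 2 powr ?p * t powr (2 - 2 * s)"
    proof -
      have "t\<^sup>2 * t powr (- ?p) * t ^ ?d = t powr (2 + (- ?p) + real ?d)"
        using t powr_numeral[of t "num.Bit0 num.One"] powr_realpow[OF t, of ?d]
        by (simp only: powr_add)
      also have "2 + (- ?p) + real ?d = 2 - 2 * s" by simp
      finally show ?thesis by simp
    qed
    also have "t powr (2 - 2 * s) = r powr (2 - 2 * s) * ((1/2) powr (2 - 2 * s)) ^ j"
    proof -
      have "t = r * (1/2) ^ j" by (simp add: t_def power_one_over)
      then show ?thesis
        using r powr_powr[of "1/2" "2 - 2 * s" "real j"] powr_powr[of "1/2" "real j" "2 - 2 * s"]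
          powr_realpow[of "1/2" j] powr_realpow[of "(1/2) powr (2 - 2 * s)" j]
        by (simp add: powr_mult mult.commute del: power_one_over)
    qed
    finally show ?thesis by (simp add: t_def)
  qed
  show ?thesis
  proof (rule integrable_of_summable_cballs[where c = c and R = "\<lambda>j. r / 2 ^ j"])
    show "summable (\<lambda>j. c j * (r / 2 ^ j) ^ ?d)"
      unfolding eq using s powr_less_mono2[of "2 - 2 * s" "1/2" 1]
      by (intro summable_mult summable_geometric) simp
  next
    fix h :: 'a
    assume "indicator (ball 0 r) h * ((norm h)\<^sup>2 * kern s (\<lambda>_. 1) h) \<noteq> 0"
    then have h: "0 < norm h" "norm h < r" by (auto split: split_indicator_asm)
    obtain j where j: "2 ^ j \<le> r / norm h" "r / norm h < 2 ^ Suc j"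
      using dyadic_scale[of "r / norm h"] h by auto
    have 1: "norm h \<le> r / 2 ^ j" and 2: "r / 2 ^ Suc j \<le> norm h"
      using j h by (auto simp: field_simps)
    have "norm h powr (- ?p) \<le> (r / 2 ^ Suc j) powr (- ?p)"
      using 2 r s by (intro powr_mono2') auto
    then have "(norm h)\<^sup>2 * norm h powr (- ?p) \<le> c j"
      unfolding c_def using 1 by (intro mult_mono power_mono) auto
    moreover have "kern s (\<lambda>_. 1) h = norm h powr (- ?p)"
      using powr_minus_divide[of "norm h" ?p] by (simp only: kern_def)
    ultimately show "\<exists>j. \<bar>indicator (ball 0 r) h * ((norm h)\<^sup>2 * kern s (\<lambda>_. 1) h)\<bar> \<le> c j \<and> norm h \<le> r / 2 ^ j"
      using 1 h by (intro exI[of _ j]) (auto split: split_indicator)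
  next
    show "(\<lambda>h::'a. indicator (ball 0 r) h * ((norm h)\<^sup>2 * kern s (\<lambda>_. 1) h)) \<in> borel_measurable borel"
    proof -
      have [measurable]: "ball (0::'a) r \<in> sets borel" by simp
      show ?thesis unfolding kern_def by measurable
    qed
  qed (use r in \<open>auto simp: c_def\<close>)
qed


lemma kern_nonneg_one: "0 \<le> kern s (\<lambda>_. 1) h"
  by (simp add: kern_def)

text \<open>
  The profile is measurable on the sphere only; extending it by \<open>0\<close> does not change the kernel.
\<close>
lemma borel_measurable_kern:
  assumes "admissible_kernel lam Lam k"
  shows "kern s k \<in> borel_measurable borel"
proof -
  have [measurable]: "(\<lambda>\<theta>. indicator (sphere 0 1) \<theta> *\<^sub>R k \<theta>) \<in> borel_measurable borel"
    using assms unfolding admissible_kernel_def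
    by (subst borel_measurable_restrict_space_iff[symmetric]) auto
  have "kern s k = (\<lambda>h. (indicator (sphere 0 1) (h /\<^sub>R norm h) *\<^sub>R k (h /\<^sub>R norm h)) /
      norm h powr (real DIM('a) + 2 * s))"
  proof (rule ext)
    fix h
    show "kern s k h = (indicator (sphere 0 1) (h /\<^sub>R norm h) *\<^sub>R k (h /\<^sub>R norm h)) /
      norm h powr (real DIM('a) + 2 * s)"
    proof (cases "h = 0")
      case False
      then have "h /\<^sub>R norm h \<in> sphere 0 1" by simp
      then show ?thesis by (simp add: kern_def indicator_def)
    qed (simp add: kern_def)
  qed
  also have "\<dots> \<in> borel_measurable borel" by measurable
  finally show ?thesis .
qed

lemma admissible_one: "admissible_kernel 1 1 (\<lambda>_. 1)"
  by (simp add: admissible_kernel_def)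

lemmas borel_measurable_kern_one [measurable] = borel_measurable_kern[OF admissible_one]

lemma kern_bounds:
  assumes "admissible_kernel lam Lam k"
  shows "lam * kern s (\<lambda>_. 1) h \<le> kern s k h" "kern s k h \<le> Lam * kern s (\<lambda>_. 1) h"
proof -
  have "lam \<le> k (h /\<^sub>R norm h) \<and> k (h /\<^sub>R norm h) \<le> Lam" if "h \<noteq> 0"
    using assms that unfolding admissible_kernel_def by auto
  then show "lam * kern s (\<lambda>_. 1) h \<le> kern s k h" "kern s k h \<le> Lam * kern s (\<lambda>_. 1) h"
    unfolding kern_def by (cases "h = 0"; simp add: divide_right_mono)+
qed

lemma kern_nonneg:
  assumes "admissible_kernel lam Lam k" "0 \<le> lam"
  shows "0 \<le> kern s k h"
  using mult_nonneg_nonneg[OF assms(2) kern_nonneg_one] kern_bounds(1)[OF assms(1)]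
  by (rule order_trans)

lemma kern_minus:
  assumes "admissible_kernel lam Lam k"
  shows "kern s k (- h) = kern s k h"
proof (cases "h = 0")
  case False
  then have "h /\<^sub>R norm h \<in> sphere 0 1" by simp
  with assms have "k (- (h /\<^sub>R norm h)) = k (h /\<^sub>R norm h)"
    unfolding admissible_kernel_def by blast
  then show ?thesis by (simp add: kern_def)
qed simp

lemma kern_one_le_weight:
  assumes "0 < s" "0 < r" "r \<le> norm (h::'a::euclidean_space)"
  shows "kern s (\<lambda>_. 1) h \<le> (1 + 1 / r) powr (real DIM('a) + 2 * s) * weight s h"
proof -
  let ?p = "real DIM('a) + 2 * s"
  have "1 + norm h \<le> (1 + 1 / r) * norm h"
    using assms by (simp add: field_simps)
  then have "(1 + norm h) powr ?p \<le> ((1 + 1 / r) * norm h) powr ?p"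
    using assms by (intro powr_mono2) auto
  also have "\<dots> = (1 + 1 / r) powr ?p * norm h powr ?p"
    using assms by (simp add: powr_mult)
  finally have "1 / norm h powr ?p \<le> (1 + 1 / r) powr ?p / (1 + norm h) powr ?p"
    using assms norm_ge_zero[of h] by (auto simp: divide_simps)
  moreover have "weight s h = 1 / (1 + norm h) powr ?p"
    unfolding weight_def powr_minus_divide[symmetric] by simp
  ultimately show ?thesis by (simp add: kern_def)
qed

lemma weight_diff_le:
  fixes x y :: "'a::euclidean_space"
  assumes "0 < s"
  shows "weight s (y - x) \<le> (1 + norm x) powr (real DIM('a) + 2 * s) * weight s y"
proof -
  let ?p = "real DIM('a) + 2 * s"
  have "norm y \<le> norm x + norm (y - x)" using norm_triangle_ineq[of x "y - x"] by simp
  moreover have "0 \<le> norm x * norm (y - x)" by simp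
  ultimately have "1 + norm y \<le> (1 + norm x) * (1 + norm (y - x))"
    unfolding distrib_left distrib_right by linarith
  then have "(1 + norm y) powr ?p \<le> ((1 + norm x) * (1 + norm (y - x))) powr ?p"
    using assms by (intro powr_mono2) auto
  also have "\<dots> = (1 + norm x) powr ?p * (1 + norm (y - x)) powr ?p"
    by (simp add: powr_mult)
  finally have le: "(1 + norm y) powr ?p \<le> (1 + norm x) powr ?p * (1 + norm (y - x)) powr ?p" .
  have pos: "0 < (1 + norm z) powr ?p" for z :: 'a
    using norm_ge_zero[of z] unfolding powr_gt_zero by linarith
  have "1 / (1 + norm (y - x)) powr ?p \<le> (1 + norm x) powr ?p / (1 + norm y) powr ?p"
    using le pos[of y] pos[of "y - x"] by (simp add: divide_simps)
  moreover have "weight s z = 1 / (1 + norm z) powr ?p" for z :: 'a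
    unfolding weight_def powr_minus_divide[symmetric] by simp
  ultimately show ?thesis by simp
qed

lemma integral_translate:
  fixes g :: "'a::euclidean_space \<Rightarrow> real"
  assumes "g \<in> borel_measurable borel"
  shows "(LINT h|lborel. g (x + h)) = (LINT h|lborel. g h)"
  using integral_distr[of "(+) x" lborel borel g] assms by (simp add: lborel_distr_plus)

lemma integrable_translate:
  fixes g :: "'a::euclidean_space \<Rightarrow> real"
  assumes "g \<in> borel_measurable borel"
  shows "integrable lborel (\<lambda>h. g (x + h)) \<longleftrightarrow> integrable lborel g"
  using integrable_distr_eq[of "(+) x" lborel borel g] assms by (simp add: lborel_distr_plus)

lemma distr_uminus: "distr lborel borel uminus = (lborel :: 'a::euclidean_space measure)"
  by (subst lborel_affine[of "-1" 0]) (auto simp: density_1)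

lemma integral_uminus:
  fixes g :: "'a::euclidean_space \<Rightarrow> real"
  assumes "g \<in> borel_measurable borel"
  shows "(LINT h|lborel. g (- h)) = (LINT h|lborel. g h)"
  using integral_distr[of uminus lborel borel g] assms by (simp add: distr_uminus)

lemma integrable_uminus:
  fixes g :: "'a::euclidean_space \<Rightarrow> real"
  assumes "g \<in> borel_measurable borel"
  shows "integrable lborel (\<lambda>h. g (- h)) \<longleftrightarrow> integrable lborel g"
  using integrable_distr_eq[of uminus lborel borel g] assms by (simp add: distr_uminus)

lemma integrable_shift_weight:
  fixes u :: "'a::euclidean_space \<Rightarrow> real"
  assumes s: "0 < s" and u: "u \<in> borel_measurable borel" "u \<in> weighted_L1 s"
  shows "integrable lborel (\<lambda>h. u (x + h) * weight s h)"
proof -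
  note [measurable] = u(1)
  have "integrable lborel (\<lambda>y. u y * weight s (y - x))"
  proof (rule Bochner_Integration.integrable_bound)
    show "integrable lborel (\<lambda>y. (1 + norm x) powr (real DIM('a) + 2 * s) * (u y * weight s y))"
      using u(2) by (simp add: weighted_L1_iff)
    show "AE y in lborel. norm (u y * weight s (y - x)) \<le>
        norm ((1 + norm x) powr (real DIM('a) + 2 * s) * (u y * weight s y))"
    proof (rule AE_I2)
      fix y
      have "\<bar>u y\<bar> * weight s (y - x) \<le> \<bar>u y\<bar> * ((1 + norm x) powr (real DIM('a) + 2 * s) * weight s y)"
        by (intro mult_left_mono weight_diff_le s) auto
      then show "norm (u y * weight s (y - x)) \<le>
          norm ((1 + norm x) powr (real DIM('a) + 2 * s) * (u y * weight s y))"
        by (simp add: abs_mult less_imp_le[OF weight_pos] mult_ac)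
    qed
  qed measurable
  then show ?thesis
    using integrable_translate[of "\<lambda>y. u y * weight s (y - x)" x] by simp
qed

section \<open>Continuity of translations\<close>

text \<open>
  The translates \<open>u (X n + h)\<close> need not have a common integrable majorant. However, moving the
  translation to the weight, which does satisfy a uniform bound, shows that their \<open>L\<^sup>1\<close> norms converge;
  together with pointwise convergence, Scheffe's lemma then gives convergence in \<open>L\<^sup>1\<close>.
\<close>
lemma tendsto_shift_weighted_L1:
  fixes u :: "'a::euclidean_space \<Rightarrow> real"
  assumes s: "0 < s" and u: "continuous_on UNIV u" "u \<in> weighted_L1 s" and X: "X \<longlonglongrightarrow> x"
  shows "(\<lambda>n. LINT h|lborel. \<bar>u (X n + h) - u (x + h)\<bar> * weight s h) \<longlonglongrightarrow> 0"
proof -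
  let ?p = "real DIM('a) + 2 * s"
  let ?F = "\<lambda>z h. u (z + h) * weight s h"
  have um [measurable]: "u \<in> borel_measurable borel"
    using u(1) by (rule borel_measurable_continuous_onI)
  have int: "integrable lborel (?F z)" for z
    using s um u(2) by (rule integrable_shift_weight)
  have norm_eq: "(LINT h|lborel. norm (?F z h)) = (LINT y|lborel. \<bar>u y\<bar> * weight s (y - z))" for z
    using integral_translate[of "\<lambda>y. \<bar>u y\<bar> * weight s (y - z)" z]
    by (simp add: abs_mult less_imp_le[OF weight_pos])
  obtain B where B: "\<And>n. norm (X n) \<le> B"
    using convergent_imp_Bseq[of X] X by (auto simp: convergent_def Bseq_def)
  have B0: "0 \<le> B" using B[of 0] norm_ge_zero[of "X 0"] by linarith
  have "(\<lambda>n. LINT y|lborel. \<bar>u y\<bar> * weight s (y - X n)) \<longlonglongrightarrow> (LINT y|lborel. \<bar>u y\<bar> * weight s (y - x))"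
  proof (rule integral_dominated_convergence)
    show "integrable lborel (\<lambda>y. (1 + B) powr ?p * \<bar>u y * weight s y\<bar>)"
      using u(2) by (simp add: weighted_L1_iff)
    show "AE y in lborel. (\<lambda>n. \<bar>u y\<bar> * weight s (y - X n)) \<longlonglongrightarrow> \<bar>u y\<bar> * weight s (y - x)"
    proof (rule AE_I2)
      fix y
      have "1 + norm z \<noteq> 0" for z :: 'a using norm_ge_zero[of z] by linarith
      then show "(\<lambda>n. \<bar>u y\<bar> * weight s (y - X n)) \<longlonglongrightarrow> \<bar>u y\<bar> * weight s (y - x)"
        unfolding weight_def by (intro tendsto_intros X) auto
    qed
    show "AE y in lborel. norm (\<bar>u y\<bar> * weight s (y - X n)) \<le> (1 + B) powr ?p * \<bar>u y * weight s y\<bar>" for n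
    proof (rule AE_I2)
      fix y
      have "weight s (y - X n) \<le> (1 + norm (X n)) powr ?p * weight s y"
        by (rule weight_diff_le[OF s])
      also have "\<dots> \<le> (1 + B) powr ?p * weight s y"
        using s B by (intro mult_right_mono powr_mono2) (auto simp: less_imp_le[OF weight_pos])
      finally have "\<bar>u y\<bar> * weight s (y - X n) \<le> \<bar>u y\<bar> * ((1 + B) powr ?p * weight s y)"
        by (intro mult_left_mono) auto
      then show "norm (\<bar>u y\<bar> * weight s (y - X n)) \<le> (1 + B) powr ?p * \<bar>u y * weight s y\<bar>"
        by (simp add: abs_mult less_imp_le[OF weight_pos] mult_ac)
    qed
  qed measurable
  then have "(\<lambda>n. LINT h|lborel. norm (?F (X n) h)) \<longlonglongrightarrow> (LINT h|lborel. norm (?F x h))"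
    by (simp only: norm_eq)
  then have lim: "(\<lambda>n. \<integral>\<^sup>+ h. norm (?F (X n) h) \<partial>lborel) \<longlonglongrightarrow> (\<integral>\<^sup>+ h. norm (?F x h) \<partial>lborel)"
    by (subst (1 2) nn_integral_eq_integral) (auto intro: integrable_norm int)
  have "(\<lambda>n. \<integral>\<^sup>+ h. norm (?F (X n) h - ?F x h) \<partial>lborel) \<longlonglongrightarrow> 0"
  proof (rule Scheffe_lemma1)
    show "AE h in lborel. (\<lambda>n. ?F (X n) h) \<longlonglongrightarrow> ?F x h"
    proof (rule AE_I2)
      fix h
      have "(\<lambda>n. u (X n + h)) \<longlonglongrightarrow> u (x + h)"
        using u(1) by (rule continuous_on_tendsto_compose) (auto intro!: tendsto_intros X)
      then show "(\<lambda>n. ?F (X n) h) \<longlonglongrightarrow> ?F x h" by (intro tendsto_intros)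
    qed
    show "limsup (\<lambda>n. \<integral>\<^sup>+ h. norm (?F (X n) h) \<partial>lborel) \<le> (\<integral>\<^sup>+ h. norm (?F x h) \<partial>lborel)"
      using lim_imp_Limsup[OF _ lim] by simp
  qed (use int in auto)
  moreover have "(\<integral>\<^sup>+ h. norm (?F (X n) h - ?F x h) \<partial>lborel) =
      ennreal (LINT h|lborel. \<bar>u (X n + h) - u (x + h)\<bar> * weight s h)" for n
  proof -
    have "norm (?F (X n) h - ?F x h) = \<bar>u (X n + h) - u (x + h)\<bar> * weight s h" for h
      by (simp add: abs_mult less_imp_le[OF weight_pos] left_diff_distrib[symmetric])
    moreover have "integrable lborel (\<lambda>h. norm (?F (X n) h - ?F x h))"
      by (intro integrable_norm Bochner_Integration.integrable_diff int)
    ultimately show ?thesis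
      by (simp add: nn_integral_eq_integral less_imp_le[OF weight_pos] del: real_norm_def)
  qed
  ultimately show ?thesis
    by (simp add: ennreal_0[symmetric] tendsto_ennreal_iff integral_nonneg_AE less_imp_le[OF weight_pos]
        del: ennreal_0)
qed


section \<open>Evaluation of the operators on test functions\<close>

definition near_moment :: "real \<Rightarrow> ('a::euclidean_space \<Rightarrow> real) \<Rightarrow> real \<Rightarrow> real" where
  "near_moment s k r = (LINT h|lborel. indicator (ball 0 r) h * ((norm h)\<^sup>2 * kern s k h))"

definition far_part ::
    "real \<Rightarrow> ('a::euclidean_space \<Rightarrow> real) \<Rightarrow> real \<Rightarrow> ('a \<Rightarrow> real) \<Rightarrow> 'a \<Rightarrow> real" where
  "far_part s k r u x =
     (LINT h|lborel. indicator (- ball 0 r) h * ((u (x + h) - u x) * kern s k h))"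

lemma integrable_near_moment:
  fixes k :: "'a::euclidean_space \<Rightarrow> real"
  assumes s: "0 < s" "s < 1" and k: "admissible_kernel lam Lam k" "0 \<le> lam" and r: "0 < r"
  shows "integrable lborel (\<lambda>h. indicator (ball 0 r) h * ((norm h)\<^sup>2 * kern s k h))"
proof (rule Bochner_Integration.integrable_bound)
  show "integrable lborel (\<lambda>h::'a. Lam * (indicator (ball 0 r) h * ((norm h)\<^sup>2 * kern s (\<lambda>_. 1) h)))"
    by (intro integrable_mult_right integrable_near_moment_one s r)
  have [measurable]: "ball (0::'a) r \<in> sets borel" by simp
  note [measurable] = borel_measurable_kern[OF k(1)]
  show "(\<lambda>h. indicator (ball 0 r) h * ((norm h)\<^sup>2 * kern s k h)) \<in> borel_measurable lborel"
    by measurable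
  show "AE h in lborel. norm (indicator (ball 0 r) h * ((norm h)\<^sup>2 * kern s k h))
      \<le> norm (Lam * (indicator (ball 0 r) h * ((norm h)\<^sup>2 * kern s (\<lambda>_. 1) h)))"
  proof (rule AE_I2)
    fix h :: 'a
    have "\<bar>kern s k h\<bar> \<le> \<bar>Lam * kern s (\<lambda>_. 1) h\<bar>"
      using kern_bounds(2)[OF k(1), of s h] kern_nonneg[OF k, of s h] by linarith
    then have "(norm h)\<^sup>2 * \<bar>kern s k h\<bar> \<le> (norm h)\<^sup>2 * \<bar>Lam * kern s (\<lambda>_. 1) h\<bar>"
      by (intro mult_left_mono) auto
    then show "norm (indicator (ball 0 r) h * ((norm h)\<^sup>2 * kern s k h))
      \<le> norm (Lam * (indicator (ball 0 r) h * ((norm h)\<^sup>2 * kern s (\<lambda>_. 1) h)))"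
      by (simp add: abs_mult mult_ac split: split_indicator)
  qed
qed

lemma near_moment_bounds:
  fixes k :: "'a::euclidean_space \<Rightarrow> real"
  assumes s: "0 < s" "s < 1" and k: "admissible_kernel lam Lam k" "0 \<le> lam" and r: "0 < r"
  shows "0 \<le> near_moment s k r"
    and "near_moment s k r \<le> Lam * near_moment s (\<lambda>_::'a. 1) r"
proof -
  show "0 \<le> near_moment s k r"
    unfolding near_moment_def
    by (intro integral_nonneg_AE AE_I2 mult_nonneg_nonneg kern_nonneg[OF k]) auto
  have "near_moment s k r \<le> (LINT h::'a|lborel. Lam * (indicator (ball 0 r) h * ((norm h)\<^sup>2 * kern s (\<lambda>_. 1) h)))"
    unfolding near_moment_def
  proof (rule integral_mono)
    fix h :: 'a
    have "(norm h)\<^sup>2 * kern s k h \<le> (norm h)\<^sup>2 * (Lam * kern s (\<lambda>_. 1) h)"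
      by (intro mult_left_mono kern_bounds(2)[OF k(1)]) auto
    then show "indicator (ball 0 r) h * ((norm h)\<^sup>2 * kern s k h)
      \<le> Lam * (indicator (ball 0 r) h * ((norm h)\<^sup>2 * kern s (\<lambda>_. 1) h))"
      by (simp add: mult_ac split: split_indicator)
  qed (use integrable_near_moment[OF s k r] integrable_near_moment_one[OF s r] in auto)
  then show "near_moment s k r \<le> Lam * near_moment s (\<lambda>_::'a. 1) r"
    by (simp add: near_moment_def)
qed

text \<open>
  This is what makes the contribution of the test functions disappear: \<open>s < 1\<close> is exactly the
  condition under which the second moment of the kernel near the origin is finite, so that it tends
  to \<open>0\<close> with the radius.
\<close>
lemma near_moment_small:
  assumes s: "0 < s" "s < 1" and "0 < \<rho>" "0 < e"
  shows "\<exists>r. 0 < r \<and> r \<le> \<rho> \<and> near_moment s (\<lambda>_::'a::euclidean_space. 1) r < e"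
proof -
  let ?r = "\<lambda>n. \<rho> / real (Suc n)"
  let ?f = "\<lambda>r (h::'a). indicator (ball 0 r) h * ((norm h)\<^sup>2 * kern s (\<lambda>_. 1) h)"
  have r0: "?r \<longlonglongrightarrow> 0" by (rule LIMSEQ_Suc[OF lim_const_over_n])
  have [measurable]: "ball (0::'a) r \<in> sets borel" for r by simp
  have "(\<lambda>n. LINT h|lborel. ?f (?r n) h) \<longlonglongrightarrow> (LINT h::'a|lborel. 0)"
  proof (rule integral_dominated_convergence)
    show "integrable lborel (?f \<rho>)" by (rule integrable_near_moment_one[OF s \<open>0 < \<rho>\<close>])
    show "AE h in lborel. (\<lambda>n. ?f (?r n) h) \<longlonglongrightarrow> 0"
    proof (rule AE_I2)
      fix h :: 'a
      show "(\<lambda>n. ?f (?r n) h) \<longlonglongrightarrow> 0"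
      proof (cases "h = 0")
        case False
        then have "\<forall>\<^sub>F n in sequentially. ?r n < norm h"
          using order_tendstoD(2)[OF r0, of "norm h"] by simp
        then have "\<forall>\<^sub>F n in sequentially. ?f (?r n) h = 0"
          by eventually_elim auto
        then show ?thesis by (rule tendsto_eventually)
      qed simp
    qed
    show "AE h in lborel. norm (?f (?r n) h) \<le> ?f \<rho> h" for n
    proof (rule AE_I2)
      fix h :: 'a
      have "?r n \<le> \<rho>" using \<open>0 < \<rho>\<close> by (simp add: field_simps)
      then show "norm (?f (?r n) h) \<le> ?f \<rho> h"
        by (auto simp: kern_nonneg_one split: split_indicator)
    qed
  qed measurable
  then have "(\<lambda>n. near_moment s (\<lambda>_::'a. 1) (?r n)) \<longlonglongrightarrow> 0"
    by (simp add: near_moment_def)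
  from order_tendstoD(2)[OF this \<open>0 < e\<close>] obtain n where "near_moment s (\<lambda>_::'a. 1) (?r n) < e"
    by (auto simp: eventually_sequentially)
  moreover have "?r n \<le> \<rho>" "0 < ?r n" using \<open>0 < \<rho>\<close> by (simp_all add: field_simps)
  ultimately show ?thesis by blast
qed

text \<open>
  Away from the origin the kernel is bounded by a multiple of the weight, with a constant
  depending on \<open>r\<close> and the class only.
\<close>
lemma integrable_far:
  fixes g :: "'a::euclidean_space \<Rightarrow> real"
  assumes s: "0 < s" and k: "admissible_kernel lam Lam k" "0 \<le> lam" and r: "0 < r"
    and g: "g \<in> borel_measurable borel" "integrable lborel (\<lambda>h. g h * weight s h)"
  shows "integrable lborel (\<lambda>h. indicator (- ball 0 r) h * (g h * kern s k h))"
proof (rule Bochner_Integration.integrable_bound)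
  let ?C = "Lam * (1 + 1 / r) powr (real DIM('a) + 2 * s)"
  show "integrable lborel (\<lambda>h. ?C * (g h * weight s h))" using g(2) by simp
  have [measurable]: "ball (0::'a) r \<in> sets borel" by simp
  note [measurable] = borel_measurable_kern[OF k(1)] g(1)
  show "(\<lambda>h. indicator (- ball 0 r) h * (g h * kern s k h)) \<in> borel_measurable lborel"
    by measurable
  show "AE h in lborel. norm (indicator (- ball 0 r) h * (g h * kern s k h)) \<le> norm (?C * (g h * weight s h))"
  proof (rule AE_I2)
    fix h :: 'a
    show "norm (indicator (- ball 0 r) h * (g h * kern s k h)) \<le> norm (?C * (g h * weight s h))"
    proof (cases "h \<in> ball 0 r")
      case False
      then have h: "r \<le> norm h" by simp
      then have pos: "0 < kern s (\<lambda>_. 1) h" using r by (auto simp: kern_def)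
      have "0 \<le> Lam * kern s (\<lambda>_. 1) h"
        using kern_bounds(2)[OF k(1), of s h] kern_nonneg[OF k, of s h] by linarith
      then have "0 \<le> Lam" using pos by (simp add: zero_le_mult_iff)
      have "kern s k h \<le> Lam * kern s (\<lambda>_. 1) h" by (rule kern_bounds(2)[OF k(1)])
      also have "\<dots> \<le> Lam * ((1 + 1 / r) powr (real DIM('a) + 2 * s) * weight s h)"
        using \<open>0 \<le> Lam\<close> by (intro mult_left_mono kern_one_le_weight s r h)
      finally have "\<bar>g h\<bar> * kern s k h \<le> \<bar>g h\<bar> * (?C * weight s h)"
        by (intro mult_left_mono) (simp_all add: mult.assoc)
      then show ?thesis
        using False \<open>0 \<le> Lam\<close> kern_nonneg[OF k, of s h] weight_pos[of s h]
        by (simp add: abs_mult mult_ac)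
    qed simp
  qed
qed

lemma integrable_far_part:
  fixes u :: "'a::euclidean_space \<Rightarrow> real"
  assumes s: "0 < s" and k: "admissible_kernel lam Lam k" "0 \<le> lam" and r: "0 < r"
    and u: "continuous_on UNIV u" "u \<in> weighted_L1 s"
  shows "integrable lborel (\<lambda>h. indicator (- ball 0 r) h * ((u (x + h) - c) * kern s k h))"
proof (rule integrable_far[OF s k r])
  have um [measurable]: "u \<in> borel_measurable borel"
    using u(1) by (rule borel_measurable_continuous_onI)
  show "(\<lambda>h. u (x + h) - c) \<in> borel_measurable borel" by measurable
  show "integrable lborel (\<lambda>h. (u (x + h) - c) * weight s h)"
    unfolding left_diff_distrib
    using integrable_shift_weight[OF s um u(2), of x] integrable_weight[OF s, where 'a = 'a]
    by (intro Bochner_Integration.integrable_diff integrable_mult_right)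
qed

text \<open>
  The linear term of the test function cancels in the symmetric difference, and in the far region
  the evenness of the kernel turns second differences into twice the first differences.
\<close>
lemma stable_op_test_function:
  fixes u :: "'a::euclidean_space \<Rightarrow> real"
  assumes s: "0 < s" "s < 1" and k: "admissible_kernel lam Lam k" "0 \<le> lam" and r: "0 < r"
    and u: "continuous_on UNIV u" "u \<in> weighted_L1 s"
  shows "stable_op s k (\<lambda>y. if y \<in> ball x r then u x + b \<bullet> (y - x) + c * (norm (y - x))\<^sup>2 else u y) x
    = c * near_moment s k r + far_part s k r u x" (is "stable_op s k ?w x = _")
proof -
  let ?N = "\<lambda>h. indicator (ball 0 r) h * ((norm h)\<^sup>2 * kern s k h)"
  let ?F = "\<lambda>h. indicator (- ball 0 r) h * ((u (x + h) - u x) * kern s k h)"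
  have split: "(?w (x + y) + ?w (x - y) - 2 * ?w x) * kern s k y = 2 * c * ?N y + ?F y + ?F (- y)" for y
  proof (cases "norm y < r")
    case True
    then show ?thesis using r by (simp add: dist_norm inner_diff_right algebra_simps)
  next
    case False
    then show ?thesis using r by (simp add: dist_norm kern_minus[OF k(1)] algebra_simps)
  qed
  have N: "integrable lborel ?N" by (rule integrable_near_moment[OF s k r])
  have F: "integrable lborel ?F" by (rule integrable_far_part[OF s(1) k r u])
  have Fm: "?F \<in> borel_measurable borel" using borel_measurable_integrable[OF F] by simp
  have F': "integrable lborel (\<lambda>y. ?F (- y))" using integrable_uminus[OF Fm] F by simp
  have "stable_op s k ?w x = 1/2 * (LINT y|lborel. 2 * c * ?N y + ?F y + ?F (- y))"
    unfolding stable_op_def split[symmetric] by (simp add: kern_def)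
  also have "(LINT y|lborel. 2 * c * ?N y + ?F y + ?F (- y)) =
      2 * c * (LINT y|lborel. ?N y) + (LINT y|lborel. ?F y) + (LINT y|lborel. ?F (- y))"
    using N F F'
    by (simp only: Bochner_Integration.integral_add Bochner_Integration.integrable_add
        integrable_mult_right integral_mult_right_zero)
  also have "(LINT y|lborel. ?F (- y)) = (LINT y|lborel. ?F y)" by (rule integral_uminus[OF Fm])
  finally show ?thesis by (simp add: near_moment_def far_part_def)
qed

lemma C2_closure_quadratic:
  "C2_closure N (\<lambda>y. a + b \<bullet> (y - x) + c * (norm (y - x))\<^sup>2)" for x :: "'a::euclidean_space"
proof -
  let ?D = "\<lambda>y. b + (2 * c) *\<^sub>R (y - x)"
  let ?H = "\<lambda>y::'a. (2 * c) *\<^sub>R (id_blinfun :: 'a \<Rightarrow>\<^sub>L 'a)"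
  have "((\<lambda>y. a + b \<bullet> (y - x) + c * ((y - x) \<bullet> (y - x))) has_derivative (\<lambda>h. ?D y \<bullet> h)) (at y)" for y
    by (rule has_derivative_eq_rhs, (rule derivative_intros)+)
      (simp add: fun_eq_iff inner_add_left inner_diff_left inner_commute algebra_simps)
  moreover have "(?D has_derivative blinfun_apply (?H y)) (at y)" for y
    by (rule has_derivative_eq_rhs, (rule derivative_intros)+) (simp add: fun_eq_iff scaleR_blinfun.rep_eq id_blinfun.rep_eq)
  ultimately show ?thesis
    unfolding C2_closure_def power2_norm_eq_inner
    by (intro exI[of _ ?D] exI[of _ ?H] conjI ballI continuous_intros) auto
qed

text \<open>
  Adding \<open>(norm (y - x))\<^sup>2\<close> to the touching paraboloid makes the contact strict, which accounts for
  \<open>c + 1\<close>. A real supremum of a nonempty set is nearly attained from below whether or not the set is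
  bounded, so one operator of the class satisfies the inequality up to \<open>e\<close>.
\<close>
lemma visc_ge_paraboloid:
  fixes u :: "'a::euclidean_space \<Rightarrow> real"
  assumes s: "0 < s" "s < 1" and lam: "0 \<le> lam"
    and L: "\<L> \<subseteq> stable_class s lam Lam" "\<L> \<noteq> {}"
    and u: "continuous_on UNIV u" "u \<in> weighted_L1 s" and visc: "visc_ge \<L> \<Omega> u f"
    and r: "0 < r" "ball x r \<subseteq> \<Omega>"
    and touch: "\<And>y. y \<in> ball x r \<Longrightarrow> u y \<le> u x + b \<bullet> (y - x) + c * (norm (y - x))\<^sup>2"
    and e: "0 < e"
  shows "\<exists>k. admissible_kernel lam Lam k \<and> stable_op s k \<in> \<L> \<and>
    f x - e < (c + 1) * near_moment s k r + far_part s k r u x"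
proof -
  let ?\<phi> = "\<lambda>y. u x + b \<bullet> (y - x) + (c + 1) * (norm (y - x))\<^sup>2"
  let ?w = "\<lambda>y. if y \<in> ball x r then ?\<phi> y else u y"
  have "u y < ?\<phi> y" if "y \<in> ball x r - {x}" for y
  proof -
    have "0 < (norm (y - x))\<^sup>2" using that by simp
    moreover have "?\<phi> y = u x + b \<bullet> (y - x) + c * (norm (y - x))\<^sup>2 + (norm (y - x))\<^sup>2"
      by (simp add: algebra_simps)
    ultimately show ?thesis using touch[OF DiffD1[OF that]] by linarith
  qed
  moreover have "x \<in> \<Omega>" using r by auto
  moreover have "C2_closure (ball x r) ?\<phi>" by (rule C2_closure_quadratic)
  ultimately have "f x \<le> sup_op \<L> ?w x"
    using r visc[unfolded visc_ge_def, THEN bspec, of x, THEN spec[of _ "ball x r"], THEN spec[of _ ?\<phi>]]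
    by simp
  then have "f x - e < (SUP L\<in>\<L>. L ?w x)" using e by (simp add: sup_op_def)
  then obtain L where "L \<in> \<L>" "f x - e < L ?w x"
    using L(2) by (auto elim!: less_cSupE)
  moreover from this L(1) obtain k where "L = stable_op s k" "admissible_kernel lam Lam k"
    unfolding stable_class_def by blast
  ultimately show ?thesis
    using stable_op_test_function[OF s _ lam r(1) u, of Lam k x b "c + 1"] by auto
qed

text \<open>
  The right-hand side is independent of \<open>k\<close>. This bounds the set of which \<open>sup_op\<close> takes the
  supremum, so that each operator of the class lies below \<open>sup_op\<close>.
\<close>
lemma far_part_bounded:
  fixes u :: "'a::euclidean_space \<Rightarrow> real"
  assumes s: "0 < s" and k: "admissible_kernel lam Lam k" "0 \<le> lam" and r: "0 < r"
    and u: "continuous_on UNIV u" "u \<in> weighted_L1 s"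
  shows "far_part s k r u x \<le>
    Lam * (LINT h|lborel. indicator (- ball 0 r) h * (\<bar>u (x + h) - u x\<bar> * kern s (\<lambda>_. 1) h))"
proof -
  let ?G = "\<lambda>h. indicator (- ball 0 r) h * (\<bar>u (x + h) - u x\<bar> * kern s (\<lambda>_. 1) h)"
  have "?G = (\<lambda>h. norm (indicator (- ball 0 r) h * ((u (x + h) - u x) * kern s (\<lambda>_. 1) h)))"
    by (simp add: fun_eq_iff abs_mult kern_nonneg_one)
  then have int: "integrable lborel ?G"
    using integrable_norm[OF integrable_far_part[OF s admissible_one zero_le_one r u]] by simp
  have "far_part s k r u x \<le> (LINT h|lborel. Lam * ?G h)"
    unfolding far_part_def
  proof (rule integral_mono[OF integrable_far_part[OF s k r u]])
    fix h
    have "(u (x + h) - u x) * kern s k h \<le> \<bar>u (x + h) - u x\<bar> * kern s k h"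
      by (intro mult_right_mono kern_nonneg[OF k]) auto
    also have "\<dots> \<le> \<bar>u (x + h) - u x\<bar> * (Lam * kern s (\<lambda>_. 1) h)"
      by (intro mult_left_mono kern_bounds(2)[OF k(1)]) auto
    finally show "indicator (- ball 0 r) h * ((u (x + h) - u x) * kern s k h) \<le> Lam * ?G h"
      by (simp add: mult_ac split: split_indicator)
  qed (use int in simp)
  then show ?thesis by simp
qed

text \<open>
  In contrast with a subsolution, a supersolution yields an inequality for every operator of the
  class. It can therefore be used with the operator that the subsolution selects.
\<close>
lemma visc_le_paraboloid:
  fixes u :: "'a::euclidean_space \<Rightarrow> real"
  assumes s: "0 < s" "s < 1" and lam: "0 \<le> lam"
    and L: "\<L> \<subseteq> stable_class s lam Lam"
    and u: "continuous_on UNIV u" "u \<in> weighted_L1 s" and visc: "visc_le \<L> \<Omega> u f"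
    and r: "0 < r" "ball x r \<subseteq> \<Omega>"
    and touch: "\<And>y. y \<in> ball x r \<Longrightarrow> u x + b \<bullet> (y - x) - c * (norm (y - x))\<^sup>2 \<le> u y"
    and k: "admissible_kernel lam Lam k" "stable_op s k \<in> \<L>"
  shows "far_part s k r u x - (c + 1) * near_moment s k r \<le> f x"
proof -
  let ?\<phi> = "\<lambda>y. u x + b \<bullet> (y - x) + (- (c + 1)) * (norm (y - x))\<^sup>2"
  let ?w = "\<lambda>y. if y \<in> ball x r then ?\<phi> y else u y"
  have "?\<phi> y < u y" if "y \<in> ball x r - {x}" for y
  proof -
    have "0 < (norm (y - x))\<^sup>2" using that by simp
    moreover have "?\<phi> y = u x + b \<bullet> (y - x) - c * (norm (y - x))\<^sup>2 - (norm (y - x))\<^sup>2"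
      by (simp add: algebra_simps)
    ultimately show ?thesis using touch[OF DiffD1[OF that]] by linarith
  qed
  moreover have "x \<in> \<Omega>" using r by auto
  moreover have "C2_closure (ball x r) ?\<phi>" by (rule C2_closure_quadratic)
  ultimately have sup: "sup_op \<L> ?w x \<le> f x"
    using r visc[unfolded visc_le_def, THEN bspec, of x, THEN spec[of _ "ball x r"], THEN spec[of _ ?\<phi>]]
    by simp
  define B where "B = \<bar>c + 1\<bar> * (Lam * near_moment s (\<lambda>_::'a. 1) r) +
    Lam * (LINT h|lborel. indicator (- ball 0 r) h * (\<bar>u (x + h) - u x\<bar> * kern s (\<lambda>_. 1) h))"
  have "L ?w x \<le> B" if "L \<in> \<L>" for L
  proof -
    from that L obtain k' where k': "L = stable_op s k'" "admissible_kernel lam Lam k'"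
      unfolding stable_class_def by blast
    have "(- (c + 1)) * near_moment s k' r \<le> \<bar>c + 1\<bar> * near_moment s k' r"
      using near_moment_bounds(1)[OF s k'(2) lam r(1)] by (intro mult_right_mono) auto
    also have "\<dots> \<le> \<bar>c + 1\<bar> * (Lam * near_moment s (\<lambda>_::'a. 1) r)"
      using near_moment_bounds(2)[OF s k'(2) lam r(1)] by (intro mult_left_mono) auto
    finally show ?thesis
      unfolding k'(1) stable_op_test_function[OF s k'(2) lam r(1) u] B_def
      using far_part_bounded[OF s(1) k'(2) lam r(1) u, of x] by linarith
  qed
  then have "bdd_above ((\<lambda>L. L ?w x) ` \<L>)" by (auto intro!: bdd_aboveI2)
  then have "stable_op s k ?w x \<le> sup_op \<L> ?w x"
    unfolding sup_op_def by (rule cSUP_upper[OF k(2)])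
  with sup show ?thesis
    unfolding stable_op_test_function[OF s k(1) lam r(1) u] by (simp add: algebra_simps)
qed


lemma integrable_far_shift_diff:
  fixes u :: "'a::euclidean_space \<Rightarrow> real"
  assumes s: "0 < s" and r: "0 < r" and u: "continuous_on UNIV u" "u \<in> weighted_L1 s"
  shows "integrable lborel (\<lambda>h. \<bar>u (y + h) - u (x + h)\<bar> * weight s h)"
    and "integrable lborel
      (\<lambda>h. indicator (- ball 0 r) h * (\<bar>u (y + h) - u (x + h)\<bar> * kern s (\<lambda>_. 1) h))"
proof -
  have um [measurable]: "u \<in> borel_measurable borel"
    using u(1) by (rule borel_measurable_continuous_onI)
  have "integrable lborel (\<lambda>h. norm (u (y + h) * weight s h - u (x + h) * weight s h))"
    by (intro integrable_norm Bochner_Integration.integrable_diff integrable_shift_weight s um u(2))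
  then show w: "integrable lborel (\<lambda>h. \<bar>u (y + h) - u (x + h)\<bar> * weight s h)"
    by (simp add: left_diff_distrib[symmetric] abs_mult less_imp_le[OF weight_pos])
  show "integrable lborel
      (\<lambda>h. indicator (- ball 0 r) h * (\<bar>u (y + h) - u (x + h)\<bar> * kern s (\<lambda>_. 1) h))"
    by (rule integrable_far[OF s admissible_one zero_le_one r _ w]) measurable
qed

text \<open>
  The reference kernel stands for the whole class here: up to the factor \<open>Lam\<close> the limit is uniform
  in the kernel. This is needed since the operator selected by the subsolution changes along the
  sequence.
\<close>
lemma tendsto_far_shift:
  fixes u :: "'a::euclidean_space \<Rightarrow> real"
  assumes s: "0 < s" and r: "0 < r"
    and u: "continuous_on UNIV u" "u \<in> weighted_L1 s" and X: "X \<longlonglongrightarrow> x"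
  shows "(\<lambda>n. LINT h|lborel.
      indicator (- ball 0 r) h * (\<bar>u (X n + h) - u (x + h)\<bar> * kern s (\<lambda>_. 1) h)) \<longlonglongrightarrow> 0"
proof -
  let ?C = "(1 + 1 / r) powr (real DIM('a) + 2 * s)"
  let ?g = "\<lambda>y h. \<bar>u (y + h) - u (x + h)\<bar>"
  note w = integrable_far_shift_diff(1)[OF s r u] and f = integrable_far_shift_diff(2)[OF s r u]
  show "(\<lambda>n. LINT h|lborel. indicator (- ball 0 r) h * (?g (X n) h * kern s (\<lambda>_. 1) h)) \<longlonglongrightarrow> 0"
  proof (rule real_tendsto_sandwich)
    show "\<forall>\<^sub>F n in sequentially. 0 \<le>
        (LINT h|lborel. indicator (- ball 0 r) h * (?g (X n) h * kern s (\<lambda>_. 1) h))"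
      by (intro always_eventually allI integral_nonneg_AE AE_I2) (simp add: kern_nonneg_one)
    show "\<forall>\<^sub>F n in sequentially.
        (LINT h|lborel. indicator (- ball 0 r) h * (?g (X n) h * kern s (\<lambda>_. 1) h))
        \<le> ?C * (LINT h|lborel. ?g (X n) h * weight s h)"
    proof (intro always_eventually allI)
      fix n
      have "(LINT h|lborel. indicator (- ball 0 r) h * (?g (X n) h * kern s (\<lambda>_. 1) h))
          \<le> (LINT h|lborel. ?C * (?g (X n) h * weight s h))"
      proof (rule integral_mono[OF f])
        show "integrable lborel (\<lambda>h. ?C * (?g (X n) h * weight s h))"
          by (intro integrable_mult_right w)
        fix h :: 'a
        show "indicator (- ball 0 r) h * (?g (X n) h * kern s (\<lambda>_. 1) h) \<le> ?C * (?g (X n) h * weight s h)"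
        proof (cases "h \<in> ball 0 r")
          case True
          then show ?thesis by (simp add: less_imp_le[OF weight_pos])
        next
          case False
          then have "?g (X n) h * kern s (\<lambda>_. 1) h \<le> ?g (X n) h * (?C * weight s h)"
            by (intro mult_left_mono kern_one_le_weight s r) auto
          with False show ?thesis by (simp add: mult_ac)
        qed
      qed
      then show "(LINT h|lborel. indicator (- ball 0 r) h * (?g (X n) h * kern s (\<lambda>_. 1) h))
        \<le> ?C * (LINT h|lborel. ?g (X n) h * weight s h)"
        by simp
    qed
    show "(\<lambda>n. ?C * (LINT h|lborel. ?g (X n) h * weight s h)) \<longlonglongrightarrow> 0"
      by (rule tendsto_mult_right_zero[OF tendsto_shift_weighted_L1[OF s u X]])
  qed simp
qed

lemma norm_diff_expand:
  fixes x a b :: "'a::real_inner"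
  shows "(norm (x - b))\<^sup>2 = (norm (a - b))\<^sup>2 + 2 * ((a - b) \<bullet> (x - a)) + (norm (x - a))\<^sup>2"
  by (simp add: power2_norm_eq_inner inner_diff_left inner_diff_right inner_commute algebra_simps)

section \<open>Comparison at a maximum by tripling the variables\<close>

lemma far_part_combination:
  fixes u v \<psi> :: "'a::euclidean_space \<Rightarrow> real" and a b c :: 'a and t :: real
  assumes s: "0 < s" and k: "admissible_kernel lam Lam k" "0 \<le> lam" and r: "0 < r"
    and u: "continuous_on UNIV u" "u \<in> weighted_L1 s"
    and v: "continuous_on UNIV v" "v \<in> weighted_L1 s"
    and \<psi>: "continuous_on UNIV \<psi>" "\<psi> \<in> weighted_L1 s"
  defines "G \<equiv> \<lambda>h. indicator (- ball 0 r) h *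
      ((u (a + h) - v (b + h) - t * \<psi> (c + h) - (u a - v b - t * \<psi> c)) * kern s k h)"
  shows "integrable lborel G"
    and "(LINT h|lborel. G h) =
      far_part s k r u a - far_part s k r v b - t * far_part s k r \<psi> c"
proof -
  note I = integrable_far_part[OF s k r u, of a "u a"]
    integrable_far_part[OF s k r v, of b "v b"]
    integrable_far_part[OF s k r \<psi>, of c "\<psi> c"]
  have eq: "G = (\<lambda>h. indicator (- ball 0 r) h * ((u (a + h) - u a) * kern s k h) -
      indicator (- ball 0 r) h * ((v (b + h) - v b) * kern s k h) -
      t * (indicator (- ball 0 r) h * ((\<psi> (c + h) - \<psi> c) * kern s k h)))"
    by (simp add: G_def fun_eq_iff algebra_simps)
  show "integrable lborel G"
    unfolding eq by (intro Bochner_Integration.integrable_diff integrable_mult_right I)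
  show "(LINT h|lborel. G h) =
      far_part s k r u a - far_part s k r v b - t * far_part s k r \<psi> c"
    unfolding eq far_part_def using I
    by (simp only: Bochner_Integration.integral_diff Bochner_Integration.integrable_diff
        integrable_mult_right integral_mult_right_zero)
qed

text \<open>
  At a maximum of the penalized function each of \<open>u\<close>, \<open>v\<close>, \<open>\<psi>\<close> is touched by a paraboloid, so the
  viscosity inequalities apply on a ball of any radius \<open>r\<close>; as \<open>r \<rightarrow> 0\<close> the paraboloids contribute nothing,
  although their opening grows with \<open>q\<close>. The penalty depends on differences of the three points only,
  hence shifting all three by the same \<open>h\<close> leaves it unchanged, and maximality says that the combined
  increment of \<open>u - v - t \<psi>\<close> is nonpositive for \<open>norm h < \<rho>\<close>. Therefore the integral over
  \<open>r \<le> norm h < \<rho>\<close> can be dropped.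
\<close>
lemma penalized_maximum_inequality:
  fixes u v \<psi> :: "'a::euclidean_space \<Rightarrow> real"
  assumes s: "0 < s" "s < 1" and lam: "0 \<le> lam" "lam \<le> Lam"
    and L: "\<L> \<subseteq> stable_class s lam Lam" "\<L> \<noteq> {}"
    and u: "continuous_on UNIV u" "u \<in> weighted_L1 s" "visc_ge \<L> \<Omega> u f1"
    and v: "continuous_on UNIV v" "v \<in> weighted_L1 s" "visc_le \<L> \<Omega> v f2"
    and \<psi>: "continuous_on UNIV \<psi>" "\<psi> \<in> weighted_L1 s" "visc_le \<L> \<Omega> \<psi> f3"
    and t: "0 < t" and q: "0 \<le> q" and \<rho>: "0 < \<rho>"
    and balls: "ball a \<rho> \<subseteq> \<Omega>" "ball b \<rho> \<subseteq> \<Omega>" "ball c \<rho> \<subseteq> \<Omega>"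
    and max: "\<And>x y p. x \<in> \<Omega> \<Longrightarrow> y \<in> \<Omega> \<Longrightarrow> p \<in> \<Omega> \<Longrightarrow>
      u x - v y - t * \<psi> p - q * ((norm (x - y))\<^sup>2 + (norm (x - p))\<^sup>2)
      \<le> u a - v b - t * \<psi> c - q * ((norm (a - b))\<^sup>2 + (norm (a - c))\<^sup>2)"
    and e: "0 < e"
  shows "\<exists>k. admissible_kernel lam Lam k \<and> f1 a - f2 b - t * f3 c \<le> e +
    (far_part s k \<rho> u a - far_part s k \<rho> v b - t * far_part s k \<rho> \<psi> c)"
proof -
  \<comment> \<open>\<open>Q\<close> collects the second-order coefficients \<open>(2 q + 1) + (q + 1) + t (q / t + 1)\<close>
    of the three test functions.\<close>
  define Q where "Q = 4 * q + 2 + t"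
  have Q: "0 < Q" using q t by (simp add: Q_def)
  have "0 < Lam * Q + 1" using lam Q by (simp add: add_nonneg_pos)
  then obtain r where r: "0 < r" "r \<le> \<rho>" "near_moment s (\<lambda>_::'a. 1) r < e / (2 * (Lam * Q + 1))"
    using near_moment_small[OF s \<rho>, of "e / (2 * (Lam * Q + 1))"] e by auto
  have sub: "ball a r \<subseteq> \<Omega>" "ball b r \<subseteq> \<Omega>" "ball c r \<subseteq> \<Omega>"
    using balls subset_ball[OF r(2)] by (meson order_trans)+
  have in\<Omega>: "a \<in> \<Omega>" "b \<in> \<Omega>" "c \<in> \<Omega>" using sub r(1) by auto
  have tu: "u x \<le> u a + ((2 * q) *\<^sub>R ((a - b) + (a - c))) \<bullet> (x - a) + (2 * q) * (norm (x - a))\<^sup>2"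
    if "x \<in> ball a r" for x
  proof -
    have "u x - v b - t * \<psi> c - q * ((norm (x - b))\<^sup>2 + (norm (x - c))\<^sup>2)
      \<le> u a - v b - t * \<psi> c - q * ((norm (a - b))\<^sup>2 + (norm (a - c))\<^sup>2)"
      using max[of x b c] that sub in\<Omega> by blast
    then show ?thesis
      unfolding norm_diff_expand[of x b a] norm_diff_expand[of x c a]
      by (simp add: inner_add_left algebra_simps)
  qed
  have tv: "v b + ((2 * q) *\<^sub>R (a - b)) \<bullet> (y - b) - q * (norm (y - b))\<^sup>2 \<le> v y"
    if "y \<in> ball b r" for y
  proof -
    have "u a - v y - t * \<psi> c - q * ((norm (a - y))\<^sup>2 + (norm (a - c))\<^sup>2)
      \<le> u a - v b - t * \<psi> c - q * ((norm (a - b))\<^sup>2 + (norm (a - c))\<^sup>2)"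
      using max[of a y c] that sub in\<Omega> by blast
    moreover have "(norm (a - y))\<^sup>2 = (norm (a - b))\<^sup>2 - 2 * ((a - b) \<bullet> (y - b)) + (norm (y - b))\<^sup>2"
      by (simp add: power2_norm_eq_inner inner_diff_left inner_diff_right inner_commute algebra_simps)
    ultimately show ?thesis
      by (simp add: algebra_simps)
  qed
  have tp: "\<psi> c + ((2 * q / t) *\<^sub>R (a - c)) \<bullet> (p - c) - (q / t) * (norm (p - c))\<^sup>2 \<le> \<psi> p"
    if "p \<in> ball c r" for p
  proof -
    have "u a - v b - t * \<psi> p - q * ((norm (a - b))\<^sup>2 + (norm (a - p))\<^sup>2)
      \<le> u a - v b - t * \<psi> c - q * ((norm (a - b))\<^sup>2 + (norm (a - c))\<^sup>2)"
      using max[of a b p] that sub in\<Omega> by blast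
    moreover have "(norm (a - p))\<^sup>2 = (norm (a - c))\<^sup>2 - 2 * ((a - c) \<bullet> (p - c)) + (norm (p - c))\<^sup>2"
      by (simp add: power2_norm_eq_inner inner_diff_left inner_diff_right inner_commute algebra_simps)
    ultimately have "t * \<psi> c + 2 * q * ((a - c) \<bullet> (p - c)) - q * (norm (p - c))\<^sup>2 \<le> t * \<psi> p"
      by (simp add: algebra_simps)
    moreover have "t * (\<psi> c + ((2 * q / t) *\<^sub>R (a - c)) \<bullet> (p - c) - (q / t) * (norm (p - c))\<^sup>2) =
        t * \<psi> c + 2 * q * ((a - c) \<bullet> (p - c)) - q * (norm (p - c))\<^sup>2"
      using t unfolding inner_scaleR_left by (simp add: field_simps)
    ultimately have "t * (\<psi> c + ((2 * q / t) *\<^sub>R (a - c)) \<bullet> (p - c) - (q / t) * (norm (p - c))\<^sup>2)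
        \<le> t * \<psi> p" by linarith
    then show ?thesis using t by (rule mult_left_le_imp_le)
  qed
  obtain k where k: "admissible_kernel lam Lam k" "stable_op s k \<in> \<L>"
    and ku: "f1 a - e / 2 < (2 * q + 1) * near_moment s k r + far_part s k r u a"
    using visc_ge_paraboloid[OF s lam(1) L u r(1) sub(1) tu, of "e / 2"] e by auto
  have kv: "far_part s k r v b - (q + 1) * near_moment s k r \<le> f2 b"
    by (rule visc_le_paraboloid[OF s lam(1) L(1) v r(1) sub(2) tv k])
  have kp: "far_part s k r \<psi> c - (q / t + 1) * near_moment s k r \<le> f3 c"
    by (rule visc_le_paraboloid[OF s lam(1) L(1) \<psi> r(1) sub(3) tp k])
  have "t * (far_part s k r \<psi> c - (q / t + 1) * near_moment s k r) \<le> t * f3 c"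
    using kp t by (intro mult_left_mono) auto
  then have kp': "t * far_part s k r \<psi> c - (q + t) * near_moment s k r \<le> t * f3 c"
    using t by (simp add: algebra_simps)
  have near: "Q * near_moment s k r \<le> e / 2"
  proof -
    have "Q * near_moment s k r \<le> Q * (Lam * near_moment s (\<lambda>_::'a. 1) r)"
      using near_moment_bounds(2)[OF s k(1) lam(1) r(1)] Q by (intro mult_left_mono) auto
    also have "\<dots> \<le> (Lam * Q + 1) * near_moment s (\<lambda>_::'a. 1) r"
      using near_moment_bounds(1)[OF s admissible_one zero_le_one r(1), where 'a = 'a]
      by (simp add: algebra_simps)
    also have "\<dots> \<le> (Lam * Q + 1) * (e / (2 * (Lam * Q + 1)))"
      using r(3) \<open>0 < Lam * Q + 1\<close> by (intro mult_left_mono) auto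
    also have "\<dots> = e / 2"
    proof -
      have "A * (e / (2 * A)) = e / 2" if "0 < A" for A :: real using that by simp
      from this[OF \<open>0 < Lam * Q + 1\<close>] show ?thesis .
    qed
    finally show ?thesis .
  qed
  let ?G = "\<lambda>h. u (a + h) - v (b + h) - t * \<psi> (c + h) - (u a - v b - t * \<psi> c)"
  note intG = far_part_combination(1)[OF s(1) k(1) lam(1) _ u(1,2) v(1,2) \<psi>(1,2), of _ a b t c]
  note G_eq = far_part_combination(2)[OF s(1) k(1) lam(1) _ u(1,2) v(1,2) \<psi>(1,2), of _ a b t c]
  have "(LINT h|lborel. indicator (- ball 0 r) h * (?G h * kern s k h))
      \<le> (LINT h|lborel. indicator (- ball 0 \<rho>) h * (?G h * kern s k h))"
  proof (rule integral_mono[OF intG[OF r(1)] intG[OF \<rho>]])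
    fix h :: 'a
    have "?G h \<le> 0" if "norm h < \<rho>"
    proof -
      have "a + h \<in> \<Omega>" "b + h \<in> \<Omega>" "c + h \<in> \<Omega>"
        using balls that by (auto simp: subset_iff dist_norm)
      from max[OF this] show ?thesis by simp
    qed
    then have "?G h * kern s k h \<le> 0" if "norm h < \<rho>"
      using that kern_nonneg[OF k(1) lam(1), of s h] by (simp add: mult_nonpos_nonneg)
    then show "indicator (- ball 0 r) h * (?G h * kern s k h) \<le> indicator (- ball 0 \<rho>) h * (?G h * kern s k h)"
      using r(2) by (auto split: split_indicator)
  qed
  moreover have "f1 a - f2 b - t * f3 c \<le> e / 2 + Q * near_moment s k r +
      (far_part s k r u a - far_part s k r v b - t * far_part s k r \<psi> c)"
    using ku kv kp' by (simp add: Q_def algebra_simps)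
  ultimately show ?thesis
    using near k(1) unfolding G_eq[OF r(1)] G_eq[OF \<rho>] by (intro exI[of _ k]) auto
qed

text \<open>
  At a global maximum all increments are nonpositive, so enlarging the excluded ball can only
  increase the integral.
\<close>
lemma far_part_at_maximum:
  fixes u :: "'a::euclidean_space \<Rightarrow> real"
  assumes "\<And>y. u y \<le> u x" and s: "0 < s" and u: "continuous_on UNIV u" "u \<in> weighted_L1 s"
    and r: "0 < r" "r \<le> R"
  shows "far_part s (\<lambda>_. 1) r u x \<le> far_part s (\<lambda>_. 1) R u x" "far_part s (\<lambda>_. 1) r u x \<le> 0"
proof -
  have neg: "(u (x + h) - u x) * kern s (\<lambda>_. 1) h \<le> 0" for h
    by (intro mult_nonpos_nonneg kern_nonneg_one) (use assms(1) in simp)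
  show "far_part s (\<lambda>_. 1) r u x \<le> far_part s (\<lambda>_. 1) R u x"
    unfolding far_part_def
    using r neg by (intro integral_mono integrable_far_part[OF s admissible_one zero_le_one _ u])
      (auto split: split_indicator)
  have "0 \<le> (LINT h|lborel. - (indicator (- ball 0 r) h * ((u (x + h) - u x) * kern s (\<lambda>_. 1) h)))"
    using neg by (intro integral_nonneg_AE AE_I2) (auto split: split_indicator)
  then show "far_part s (\<lambda>_. 1) r u x \<le> 0"
    unfolding far_part_def by simp
qed

lemma weighted_L1_combination:
  assumes "u \<in> weighted_L1 s" "v \<in> weighted_L1 s" "w \<in> weighted_L1 s"
  shows "(\<lambda>x. u x - v x - t * w x) \<in> weighted_L1 s"
proof -
  have "(u x - v x - t * w x) * weight s x = u x * weight s x - v x * weight s x - t * (w x * weight s x)" for x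
    by (simp add: algebra_simps)
  then show ?thesis
    using assms unfolding weighted_L1_iff
    by (simp only:) (intro Bochner_Integration.integrable_diff integrable_mult_right)
qed

text \<open>
  The combination formed at three points differs from the one at \<open>x\<close> by errors measured in the
  reference kernel. The main term has a nonpositive integrand because \<open>x\<close> is a maximum point, and so the
  lower bound \<open>lam\<close> on the kernel may be used there: the result no longer refers to \<open>k\<close>.
\<close>
lemma far_part_near_maximum:
  fixes u v \<psi> :: "'a::euclidean_space \<Rightarrow> real" and x :: 'a
  assumes s: "0 < s" and k: "admissible_kernel lam Lam k" "0 \<le> lam" and r: "0 < r" and t: "0 \<le> t"
    and u: "continuous_on UNIV u" "u \<in> weighted_L1 s"
    and v: "continuous_on UNIV v" "v \<in> weighted_L1 s"
    and \<psi>: "continuous_on UNIV \<psi>" "\<psi> \<in> weighted_L1 s"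
    and max: "\<And>y. u y - v y - t * \<psi> y \<le> u x - v x - t * \<psi> x"
  defines "D \<equiv> \<lambda>g y. LINT h|lborel.
      indicator (- ball 0 r) h * (\<bar>g (y + h) - g (x + h)\<bar> * kern s (\<lambda>_. 1) h)"
  shows "far_part s k r u a - far_part s k r v b - t * far_part s k r \<psi> c \<le>
    lam * far_part s (\<lambda>_. 1) r (\<lambda>y. u y - v y - t * \<psi> y) x +
    Lam * (D u a + D v b + t * D \<psi> c +
      \<bar>u a - v b - t * \<psi> c - (u x - v x - t * \<psi> x)\<bar> *
        (LINT h::'a|lborel. indicator (- ball 0 r) h * kern s (\<lambda>_. 1) h))"
proof -
  let ?I = "\<lambda>h::'a. indicator (- ball 0 r) h :: real"
  let ?K = "\<lambda>h::'a. kern s (\<lambda>_. 1) h"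
  let ?d = "\<lambda>g y h. ?I h * (\<bar>g (y + h) - g (x + h)\<bar> * ?K h)"
  let ?e = "\<bar>u a - v b - t * \<psi> c - (u x - v x - t * \<psi> x)\<bar>"
  define z where "z = (\<lambda>y. u y - v y - t * \<psi> y)"
  have z: "continuous_on UNIV z" "z \<in> weighted_L1 s"
    unfolding z_def using u v \<psi> by (auto intro!: continuous_intros weighted_L1_combination)
  let ?z = "\<lambda>h. ?I h * ((z (x + h) - z x) * ?K h)"
  let ?M = "\<lambda>h. lam * ?z h + Lam * (?d u a h + ?d v b h + t * ?d \<psi> c h + ?e * (?I h * ?K h))"
  let ?G = "\<lambda>h. u (a + h) - v (b + h) - t * \<psi> (c + h) - (u a - v b - t * \<psi> c)"
  have w: "integrable lborel (\<lambda>h. ?I h * ?K h)"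
    using integrable_far[OF s admissible_one zero_le_one r, of "\<lambda>_. 1"]
      integrable_weight[OF s, where 'a = 'a] by simp
  note ints = integrable_far_part[OF s admissible_one zero_le_one r z, of x "z x"] w
    integrable_far_shift_diff(2)[OF s r u, of a x] integrable_far_shift_diff(2)[OF s r v, of b x]
    integrable_far_shift_diff(2)[OF s r \<psi>, of c x]
  have intM: "integrable lborel ?M"
    by (intro integrable_mult_right Bochner_Integration.integrable_add ints)
  have "(LINT h|lborel. ?I h * (?G h * kern s k h)) \<le> (LINT h|lborel. ?M h)"
  proof (rule integral_mono[OF far_part_combination(1)[OF s k r u v \<psi>] intM])
    fix h :: 'a
    show "?I h * (?G h * kern s k h) \<le> ?M h"
    proof (cases "h \<in> ball 0 r")
      case False
      have "(z (x + h) - z x) * kern s k h \<le> (z (x + h) - z x) * (lam * ?K h)"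
        using max[of "x + h"] by (intro mult_left_mono_neg kern_bounds(1)[OF k(1)]) (simp add: z_def)
      moreover have "(?G h - (z (x + h) - z x)) * kern s k h \<le>
          (\<bar>u (a + h) - u (x + h)\<bar> + \<bar>v (b + h) - v (x + h)\<bar> + t * \<bar>\<psi> (c + h) - \<psi> (x + h)\<bar> + ?e) * (Lam * ?K h)"
      proof (rule mult_mono)
        have "t * (\<psi> (x + h) - \<psi> (c + h)) \<le> t * \<bar>\<psi> (c + h) - \<psi> (x + h)\<bar>"
          using t by (intro mult_left_mono) auto
        then show "?G h - (z (x + h) - z x) \<le>
          \<bar>u (a + h) - u (x + h)\<bar> + \<bar>v (b + h) - v (x + h)\<bar> + t * \<bar>\<psi> (c + h) - \<psi> (x + h)\<bar> + ?e"
          unfolding z_def right_diff_distrib by linarith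
      qed (use t kern_bounds(2)[OF k(1)] kern_nonneg[OF k] in auto)
      ultimately show ?thesis using False by (simp add: algebra_simps)
    qed simp
  qed
  also have "\<dots> = lam * far_part s (\<lambda>_. 1) r z x +
      Lam * (D u a + D v b + t * D \<psi> c + ?e * (LINT h|lborel. ?I h * ?K h))"
    unfolding far_part_def D_def using ints
    by (simp only: Bochner_Integration.integral_add Bochner_Integration.integrable_add
        integrable_mult_right integral_mult_right_zero)
  finally show ?thesis
    unfolding far_part_combination(2)[OF s k r u v \<psi>] z_def .
qed

text \<open>
  This is the substitute for evaluating the operators at a maximum of \<open>u - v - t \<psi>\<close>, where none of
  the three functions needs to be differentiable. The penalization forces the three maximizing points to
  a common limit, which is a maximum point of \<open>u - v - t \<psi>\<close>; the inequalities obtained for the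
  penalized problems pass to the limit.
\<close>
lemma comparison_at_maximum:
  fixes u v \<psi> :: "'a::euclidean_space \<Rightarrow> real"
  assumes s: "0 < s" "s < 1" and lam: "0 \<le> lam" "lam \<le> Lam"
    and L: "\<L> \<subseteq> stable_class s lam Lam" "\<L> \<noteq> {}"
    and \<Omega>: "open \<Omega>" "bounded \<Omega>"
    and u: "continuous_on UNIV u" "u \<in> weighted_L1 s" "visc_ge \<L> \<Omega> u f1"
    and v: "continuous_on UNIV v" "v \<in> weighted_L1 s" "visc_le \<L> \<Omega> v f2"
    and \<psi>: "continuous_on UNIV \<psi>" "\<psi> \<in> weighted_L1 s" "visc_le \<L> \<Omega> \<psi> f3"
    and f: "continuous_on \<Omega> f1" "continuous_on \<Omega> f2" "continuous_on \<Omega> f3"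
    and t: "0 < t"
    and out: "\<And>x. x \<notin> \<Omega> \<Longrightarrow> u x - v x - t * \<psi> x \<le> 0"
    and pos: "0 < u x\<^sub>1 - v x\<^sub>1 - t * \<psi> x\<^sub>1"
  shows "\<exists>x\<in>\<Omega>. (\<forall>y. u y - v y - t * \<psi> y \<le> u x - v x - t * \<psi> x) \<and>
    (\<forall>R>0. f1 x - f2 x - t * f3 x \<le> lam * far_part s (\<lambda>_. 1) R (\<lambda>y. u y - v y - t * \<psi> y) x)"
proof -
  define z where "z = (\<lambda>x. u x - v x - t * \<psi> x)"
  define K where "K = closure \<Omega>"
  have K: "compact K" "\<Omega> \<subseteq> K" unfolding K_def using \<Omega>(2) by (auto simp: closure_subset)
  have x1: "x\<^sub>1 \<in> \<Omega>" using out[of x\<^sub>1] pos by force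
  have z: "continuous_on UNIV z" "z \<in> weighted_L1 s"
    unfolding z_def using u v \<psi> by (auto intro!: continuous_intros weighted_L1_combination)
  define \<Phi> where "\<Phi> = (\<lambda>n (x, y, p). u x - v y - t * \<psi> p - real n * ((norm (x - y))\<^sup>2 + (norm (x - p))\<^sup>2))"
  have cont: "continuous_on UNIV (\<Phi> n)" for n
  proof -
    have c: "continuous_on UNIV (\<lambda>w. g (h w))" if "continuous_on UNIV g" "continuous_on UNIV h"
      for g :: "'a \<Rightarrow> real" and h :: "'a \<times> 'a \<times> 'a \<Rightarrow> 'a"
      using continuous_on_compose2[OF that(1) that(2)] by auto
    show ?thesis
      unfolding \<Phi>_def case_prod_beta using u(1) v(1) \<psi>(1)
      by (intro continuous_intros c) auto
  qed
  have "\<exists>w\<in>K \<times> K \<times> K. \<forall>w'\<in>K \<times> K \<times> K. \<Phi> n w' \<le> \<Phi> n w" for n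
    using K x1 by (intro continuous_attains_sup compact_Times continuous_on_subset[OF cont]) auto
  then obtain W where W: "\<And>n. W n \<in> K \<times> K \<times> K" "\<And>n w'. w' \<in> K \<times> K \<times> K \<Longrightarrow> \<Phi> n w' \<le> \<Phi> n (W n)"
    by metis
  define X Y P where "X = (\<lambda>n. fst (W n))" and "Y = (\<lambda>n. fst (snd (W n)))" and "P = (\<lambda>n. snd (snd (W n)))"
  have XYP: "X n \<in> K" "Y n \<in> K" "P n \<in> K" for n
    using W(1)[of n] by (auto simp: X_def Y_def P_def)
  have max: "u x - v y - t * \<psi> p - real n * ((norm (x - y))\<^sup>2 + (norm (x - p))\<^sup>2)
      \<le> u (X n) - v (Y n) - t * \<psi> (P n) - real n * ((norm (X n - Y n))\<^sup>2 + (norm (X n - P n))\<^sup>2)"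
    if "x \<in> K" "y \<in> K" "p \<in> K" for n x y p
    using W(2)[of "(x, y, p)" n] that by (simp add: \<Phi>_def X_def Y_def P_def case_prod_beta)
  define F where "F = (\<lambda>n. u (X n) - v (Y n) - t * \<psi> (P n))"
  have F: "z x + real n * ((norm (X n - Y n))\<^sup>2 + (norm (X n - P n))\<^sup>2) \<le> F n" if "x \<in> K" for n x
    using max[OF that that that, of n] by (simp add: z_def F_def)
  obtain B where B: "\<And>n. F n \<le> B"
  proof -
    have "compact (\<Phi> 0 ` (K \<times> K \<times> K))"
      using K by (intro compact_continuous_image compact_Times continuous_on_subset[OF cont]) auto
    then have "bdd_above (\<Phi> 0 ` (K \<times> K \<times> K))"
      by (intro bounded_imp_bdd_above compact_imp_bounded)
    then obtain B where "\<And>w. w \<in> K \<times> K \<times> K \<Longrightarrow> \<Phi> 0 w \<le> B" unfolding bdd_above_def by blast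
    from this[OF W(1)] have "F n \<le> B" for n
      by (simp add: \<Phi>_def F_def X_def Y_def P_def case_prod_beta)
    with that show ?thesis by blast
  qed
  have close: "(\<lambda>n. (norm (X n - Y n))\<^sup>2 + (norm (X n - P n))\<^sup>2) \<longlonglongrightarrow> 0"
  proof (rule real_tendsto_sandwich[where f = "\<lambda>_. 0" and h = "\<lambda>n. (B - z x\<^sub>1) / real n"])
    show "\<forall>\<^sub>F n in sequentially. (norm (X n - Y n))\<^sup>2 + (norm (X n - P n))\<^sup>2 \<le> (B - z x\<^sub>1) / real n"
      using eventually_gt_at_top[of "0::nat"]
    proof eventually_elim
      case (elim n)
      have "real n * ((norm (X n - Y n))\<^sup>2 + (norm (X n - P n))\<^sup>2) \<le> B - z x\<^sub>1"
        using F[of x\<^sub>1 n] B[of n] x1 K by auto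
      then show ?case using elim by (simp add: field_simps)
    qed
    show "(\<lambda>n. (B - z x\<^sub>1) / real n) \<longlonglongrightarrow> 0" by (rule lim_const_over_n)
  qed auto
  have XY: "(\<lambda>n. X n - Y n) \<longlonglongrightarrow> 0" and XP: "(\<lambda>n. X n - P n) \<longlonglongrightarrow> 0"
  proof -
    have lim: "(\<lambda>n. sqrt ((norm (X n - Y n))\<^sup>2 + (norm (X n - P n))\<^sup>2)) \<longlonglongrightarrow> 0"
      using tendsto_real_sqrt[OF close] by simp
    have le: "\<forall>n. norm (X n - Y n) \<le> sqrt ((norm (X n - Y n))\<^sup>2 + (norm (X n - P n))\<^sup>2)"
      "\<forall>n. norm (X n - P n) \<le> sqrt ((norm (X n - Y n))\<^sup>2 + (norm (X n - P n))\<^sup>2)"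
      by (auto intro!: real_le_rsqrt)
    show "(\<lambda>n. X n - Y n) \<longlonglongrightarrow> 0" by (rule Lim_null_comparison[OF always_eventually[OF le(1)] lim])
    show "(\<lambda>n. X n - P n) \<longlonglongrightarrow> 0" by (rule Lim_null_comparison[OF always_eventually[OF le(2)] lim])
  qed
  obtain x\<^sub>0 \<sigma> where x0: "x\<^sub>0 \<in> K" "strict_mono (\<sigma> :: nat \<Rightarrow> nat)" "(X \<circ> \<sigma>) \<longlonglongrightarrow> x\<^sub>0"
    using K(1) XYP(1) unfolding compact_def by meson
  have Xl: "(\<lambda>n. X (\<sigma> n)) \<longlonglongrightarrow> x\<^sub>0" using x0(3) by (simp add: o_def)
  have Yl: "(\<lambda>n. Y (\<sigma> n)) \<longlonglongrightarrow> x\<^sub>0"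
    using tendsto_diff[OF Xl LIMSEQ_subseq_LIMSEQ[OF XY x0(2)]] by (simp add: o_def)
  have Pl: "(\<lambda>n. P (\<sigma> n)) \<longlonglongrightarrow> x\<^sub>0"
    using tendsto_diff[OF Xl LIMSEQ_subseq_LIMSEQ[OF XP x0(2)]] by (simp add: o_def)
  have Fl: "(\<lambda>n. F (\<sigma> n)) \<longlonglongrightarrow> z x\<^sub>0"
    unfolding F_def z_def
    by (intro tendsto_intros continuous_on_tendsto_compose[OF u(1) Xl]
        continuous_on_tendsto_compose[OF v(1) Yl] continuous_on_tendsto_compose[OF \<psi>(1) Pl]) auto
  have zK: "z x \<le> z x\<^sub>0" if "x \<in> K" for x
  proof (rule LIMSEQ_le_const[OF Fl])
    have "z x \<le> F n" for n
    proof -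
      have "0 \<le> real n * ((norm (X n - Y n))\<^sup>2 + (norm (X n - P n))\<^sup>2)" by simp
      with F[OF that, of n] show ?thesis by linarith
    qed
    then show "\<exists>N. \<forall>n\<ge>N. z x \<le> F (\<sigma> n)" by blast
  qed
  have z0: "0 < z x\<^sub>0" using zK[of x\<^sub>1] x1 K pos by (auto simp: z_def)
  have zmax: "z x \<le> z x\<^sub>0" for x
    using zK[of x] out[of x] z0 K(2) by (cases "x \<in> \<Omega>") (auto simp: z_def)
  have x0\<Omega>: "x\<^sub>0 \<in> \<Omega>" using out[of x\<^sub>0] z0 by (force simp: z_def)
  have "f1 x\<^sub>0 - f2 x\<^sub>0 - t * f3 x\<^sub>0 \<le> lam * far_part s (\<lambda>_. 1) R z x\<^sub>0" if R: "0 < R" for R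
  proof -
    obtain \<rho>0 where \<rho>0: "0 < \<rho>0" "ball x\<^sub>0 \<rho>0 \<subseteq> \<Omega>" using \<Omega>(1) x0\<Omega> by (meson openE)
    define \<rho> where "\<rho> = min R (\<rho>0 / 2)"
    have \<rho>: "0 < \<rho>" "\<rho> \<le> R" "2 * \<rho> \<le> \<rho>0" using R \<rho>0 by (auto simp: \<rho>_def)
    have near: "ball x \<rho> \<subseteq> \<Omega>" if "dist x x\<^sub>0 < \<rho>" for x
    proof
      fix y assume "y \<in> ball x \<rho>"
      then have "dist x\<^sub>0 y < \<rho>0"
        using that \<rho>(3) dist_triangle[of x\<^sub>0 y x] by (simp add: dist_commute)
      then show "y \<in> \<Omega>" using \<rho>0 by auto
    qed
    let ?D = "\<lambda>g a. LINT h|lborel.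
      indicator (- ball 0 \<rho>) h * (\<bar>g (a + h) - g (x\<^sub>0 + h)\<bar> * kern s (\<lambda>_. 1) h)"
    define E where "E = (\<lambda>n. ?D u (X (\<sigma> n)) + ?D v (Y (\<sigma> n)) + t * ?D \<psi> (P (\<sigma> n)) +
      \<bar>F (\<sigma> n) - z x\<^sub>0\<bar> * (LINT h::'a|lborel. indicator (- ball 0 \<rho>) h * kern s (\<lambda>_. 1) h))"
    have Flim: "(\<lambda>n. \<bar>F (\<sigma> n) - z x\<^sub>0\<bar>) \<longlonglongrightarrow> 0"
      by (rule tendsto_rabs_zero) (use Fl in \<open>simp add: LIM_zero\<close>)
    have "E \<longlonglongrightarrow> 0 + 0 + t * 0 + 0 * (LINT h::'a|lborel. indicator (- ball 0 \<rho>) h * kern s (\<lambda>_. 1) h)"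
      unfolding E_def
      by (intro tendsto_add tendsto_mult tendsto_const Flim tendsto_far_shift[OF s(1) \<rho>(1)]
          u(1,2) v(1,2) \<psi>(1,2) Xl Yl Pl)
    then have El: "E \<longlonglongrightarrow> 0" by simp
    let ?b = "\<lambda>n. 1 / real (Suc n) + (lam * far_part s (\<lambda>_. 1) \<rho> z x\<^sub>0 + Lam * E n)"
    have "\<forall>\<^sub>F n in sequentially. f1 (X (\<sigma> n)) - f2 (Y (\<sigma> n)) - t * f3 (P (\<sigma> n)) \<le> ?b n"
      using tendstoD[OF Xl \<rho>(1)] tendstoD[OF Yl \<rho>(1)] tendstoD[OF Pl \<rho>(1)]
    proof eventually_elim
      case (elim n)
      let ?a = "X (\<sigma> n)" and ?b = "Y (\<sigma> n)" and ?c = "P (\<sigma> n)"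
      have "\<exists>k. admissible_kernel lam Lam k \<and> f1 ?a - f2 ?b - t * f3 ?c \<le> 1 / real (Suc n) +
          (far_part s k \<rho> u ?a - far_part s k \<rho> v ?b - t * far_part s k \<rho> \<psi> ?c)"
      proof (rule penalized_maximum_inequality[OF s lam L u v \<psi> t of_nat_0_le_iff \<rho>(1)
            near[OF elim(1)] near[OF elim(2)] near[OF elim(3)]])
        fix x y p assume "x \<in> \<Omega>" "y \<in> \<Omega>" "p \<in> \<Omega>"
        then show "u x - v y - t * \<psi> p - real (\<sigma> n) * ((norm (x - y))\<^sup>2 + (norm (x - p))\<^sup>2)
            \<le> u ?a - v ?b - t * \<psi> ?c - real (\<sigma> n) * ((norm (?a - ?b))\<^sup>2 + (norm (?a - ?c))\<^sup>2)"
          using max[of x y p "\<sigma> n"] K(2) by blast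
      qed simp
      then obtain k where k: "admissible_kernel lam Lam k" and
        ineq: "f1 ?a - f2 ?b - t * f3 ?c \<le> 1 / real (Suc n) +
          (far_part s k \<rho> u ?a - far_part s k \<rho> v ?b - t * far_part s k \<rho> \<psi> ?c)"
        by blast
      have "far_part s k \<rho> u ?a - far_part s k \<rho> v ?b - t * far_part s k \<rho> \<psi> ?c
          \<le> lam * far_part s (\<lambda>_. 1) \<rho> z x\<^sub>0 + Lam * E n"
        unfolding E_def F_def z_def
        by (rule far_part_near_maximum[OF s(1) k lam(1) \<rho>(1) less_imp_le[OF t] u(1,2) v(1,2) \<psi>(1,2)])
          (use zmax in \<open>simp add: z_def\<close>)
      with ineq show ?case by linarith
    qed
    moreover have "?b \<longlonglongrightarrow> 0 + (lam * far_part s (\<lambda>_. 1) \<rho> z x\<^sub>0 + Lam * 0)"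
      by (intro tendsto_intros El LIMSEQ_Suc[OF lim_const_over_n])
    moreover have "(\<lambda>n. f1 (X (\<sigma> n)) - f2 (Y (\<sigma> n)) - t * f3 (P (\<sigma> n)))
        \<longlonglongrightarrow> f1 x\<^sub>0 - f2 x\<^sub>0 - t * f3 x\<^sub>0"
    proof -
      have "(\<lambda>n. g (Z n)) \<longlonglongrightarrow> g x\<^sub>0" if "continuous_on \<Omega> g" "Z \<longlonglongrightarrow> x\<^sub>0"
        for g :: "'a \<Rightarrow> real" and Z
      proof -
        have "isCont g x\<^sub>0" using that(1) \<Omega>(1) x0\<Omega> by (simp add: continuous_on_eq_continuous_at)
        then show ?thesis using that(2) by (rule isCont_tendsto_compose)
      qed
      then show ?thesis using f Xl Yl Pl by (intro tendsto_intros) auto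
    qed
    ultimately have "f1 x\<^sub>0 - f2 x\<^sub>0 - t * f3 x\<^sub>0 \<le> lam * far_part s (\<lambda>_. 1) \<rho> z x\<^sub>0"
      using tendsto_le[OF sequentially_bot] by fastforce
    also have "\<dots> \<le> lam * far_part s (\<lambda>_. 1) R z x\<^sub>0"
      using far_part_at_maximum(1)[OF zmax s(1) z \<rho>(1,2)] lam(1) by (rule mult_left_mono)
    finally show ?thesis .
  qed
  with zmax x0\<Omega> show ?thesis unfolding z_def by blast
qed


section \<open>Domains of small measure\<close>

text \<open>
  Outside \<open>E\<close> the function is nonpositive, so a jump \<open>h\<close> from \<open>x\<close> in the annulus \<open>r \<le> norm h < 2 r\<close>
  that leaves \<open>E\<close> loses at least \<open>z x\<close>. If \<open>E\<close> has at
  most half the measure of a ball of radius \<open>r\<close>, then it cannot contain the annulus, whose measure is at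
  least that of the full ball, and at least half a ball of jumps remains.
\<close>
lemma far_part_small_positivity_set:
  fixes z :: "'a::euclidean_space \<Rightarrow> real"
  assumes s: "0 < s" and z: "continuous_on UNIV z" "z \<in> weighted_L1 s"
    and max: "\<And>y. z y \<le> z x" and r: "0 < r"
    and E: "E \<in> sets lborel" "\<And>y. 0 < z y \<Longrightarrow> y \<in> E"
    and small: "emeasure lborel E \<le> ennreal (unit_ball_vol DIM('a) * r ^ DIM('a) / 2)"
    and pos: "0 < z x"
  shows "far_part s (\<lambda>_. 1) r z x \<le>
    - (z x * (unit_ball_vol DIM('a) * r ^ DIM('a) / 2 / (2 * r) powr (real DIM('a) + 2 * s)))"
proof -
  let ?d = "DIM('a)" and ?p = "real DIM('a) + 2 * s"
  define V where "V = unit_ball_vol (real ?d)"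
  define S where "S = (\<lambda>h. x + h) -` E"
  define A where "A = ball (0::'a) (2 * r) - ball 0 r - S"
  have V: "0 < V" by (simp add: V_def)
  have S: "S \<in> sets lborel"
    unfolding S_def using measurable_sets[of "\<lambda>h. x + h" lborel lborel E] E(1) by simp
  then have A: "A \<in> sets lborel" by (simp add: A_def)
  have eS: "emeasure lborel S = emeasure lborel E"
    using emeasure_distr[of "(+) x" lborel borel E] E(1) by (simp add: lborel_distr_plus S_def)
  have fS: "S \<in> fmeasurable lborel"
    using S eS le_less_trans[OF small ennreal_less_top] unfolding fmeasurable_def by simp
  have mS: "measure lborel S \<le> V * r ^ ?d / 2"
  proof -
    have "measure lborel S = enn2real (emeasure lborel E)" by (simp add: measure_def eS)
    also have "\<dots> \<le> V * r ^ ?d / 2"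
      by (rule enn2real_leI) (use small V r in \<open>auto simp: V_def\<close>)
    finally show ?thesis .
  qed
  have fB: "ball (0::'a) R \<in> fmeasurable lborel" for R
    using emeasure_bounded_finite[OF bounded_ball, of "0::'a" R] by (simp add: fmeasurable_def)
  have fA: "A \<in> fmeasurable lborel"
    unfolding A_def by (intro fmeasurable.Diff fmeasurableD fB fS)
  have mA: "V * r ^ ?d / 2 \<le> measure lborel A"
  proof -
    have "measure lborel (ball (0::'a) (2 * r)) \<le> measure lborel (ball 0 r \<union> S \<union> A)"
      by (intro measure_mono_fmeasurable fmeasurable.Un fmeasurableD fB fS fA) (auto simp: A_def)
    also have "\<dots> \<le> measure lborel (ball (0::'a) r) + measure lborel S + measure lborel A"
      using measure_Un_le[of "ball (0::'a) r \<union> S" lborel A] measure_Un_le[of "ball (0::'a) r" lborel S] S A by simp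
    finally have "V * (2 * r) ^ ?d \<le> V * r ^ ?d + V * r ^ ?d / 2 + measure lborel A"
      using mS r content_ball[of r "0::'a"] content_ball[of "2 * r" "0::'a"]
      by (simp add: V_def measure_completion)
    moreover have "2 * (V * r ^ ?d) \<le> V * (2 * r) ^ ?d"
    proof -
      have "(2::real) ^ 1 \<le> 2 ^ ?d" by (rule power_increasing) (auto simp: Suc_leI)
      then have "2 * (V * r ^ ?d) \<le> 2 ^ ?d * (V * r ^ ?d)"
        using V r by (intro mult_right_mono) auto
      then show ?thesis by (simp add: power_mult_distrib mult_ac)
    qed
    ultimately show ?thesis by linarith
  qed
  have "far_part s (\<lambda>_. 1) r z x \<le> (LINT h|lborel. (- z x / (2 * r) powr ?p) * indicator A h)"
    unfolding far_part_def
  proof (rule integral_mono[OF integrable_far_part[OF s admissible_one zero_le_one r z]])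
    show "integrable lborel (\<lambda>h. (- z x / (2 * r) powr ?p) * indicator A h)"
      using fA by (intro integrable_mult_right) (simp add: fmeasurable_def less_top)
    fix h :: 'a
    show "indicator (- ball 0 r) h * ((z (x + h) - z x) * kern s (\<lambda>_. 1) h)
      \<le> (- z x / (2 * r) powr ?p) * indicator A h"
    proof (cases "h \<in> A")
      case True
      then have h: "r \<le> norm h" "norm h < 2 * r" "x + h \<notin> E" by (auto simp: A_def S_def)
      have "z (x + h) \<le> 0" using E(2)[of "x + h"] h(3) by force
      have "norm h powr ?p \<le> (2 * r) powr ?p" using h s by (intro powr_mono2) auto
      moreover have "0 < norm h powr ?p" using h r by auto
      ultimately have "1 / (2 * r) powr ?p \<le> kern s (\<lambda>_. 1) h"
        unfolding kern_def by (intro divide_left_mono mult_pos_pos) auto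
      then have "z x * (1 / (2 * r) powr ?p) \<le> (z x - z (x + h)) * kern s (\<lambda>_. 1) h"
        using pos \<open>z (x + h) \<le> 0\<close> by (intro mult_mono) auto
      then show ?thesis using True h by (simp add: algebra_simps)
    next
      case False
      have "(z (x + h) - z x) * kern s (\<lambda>_. 1) h \<le> 0"
        using max[of "x + h"] by (intro mult_nonpos_nonneg kern_nonneg_one) auto
      then show ?thesis using False by (auto split: split_indicator)
    qed
  qed
  also have "\<dots> = - (z x * (measure lborel A / (2 * r) powr ?p))" by simp
  also have "\<dots> \<le> - (z x * (V * r ^ ?d / 2 / (2 * r) powr ?p))"
    using mA pos by (intro le_imp_neg_le mult_left_mono divide_right_mono) auto
  finally show ?thesis by (simp only: V_def)
qed

text \<open>
  The quantity is a constant times \<open>r powr (- 2 s)\<close>. On sets of small measure the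
  loss at a maximum therefore dominates a zero-order term with any coefficient.
\<close>
lemma annulus_mass_large:
  fixes d :: nat and s C V :: real
  assumes "0 < s" "0 < V"
  shows "\<exists>r>0. C < V * r ^ d / 2 / (2 * r) powr (real d + 2 * s)"
proof -
  let ?p = "real d + 2 * s"
  define B where "B = (\<bar>C\<bar> + 1) * (2 * 2 powr ?p) / V"
  define r where "r = B powr (- 1 / (2 * s))"
  have B: "0 < B" using assms by (auto simp: B_def intro!: divide_pos_pos mult_pos_pos)
  have r: "0 < r" using B by (simp add: r_def)
  have "r powr (2 * s) = B powr (- 1)"
    unfolding r_def powr_powr using assms by simp
  then have "r powr (2 * s) = 1 / B"
    using powr_minus_divide[of B 1] B by simp
  then have "V * r ^ d / 2 / (2 * r) powr ?p = V * B / (2 * 2 powr ?p)"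
    using r B by (simp add: powr_mult powr_add powr_realpow)
  also have "\<dots> = \<bar>C\<bar> + 1" using assms by (simp add: B_def)
  finally show ?thesis using r by (intro exI[of _ r]) auto
qed

lemma sublevel_measure_small:
  fixes \<psi> :: "'a::euclidean_space \<Rightarrow> real"
  assumes \<Omega>: "open \<Omega>" "bounded \<Omega>" and \<psi>: "continuous_on UNIV \<psi>" "\<And>x. x \<in> \<Omega> \<Longrightarrow> 0 < \<psi> x"
    and \<delta>: "0 < \<delta>"
  shows "\<exists>t>0. {x \<in> \<Omega>. t * \<psi> x < C} \<in> sets lborel \<and> emeasure lborel {x \<in> \<Omega>. t * \<psi> x < C} \<le> ennreal \<delta>"
proof -
  define A where "A = (\<lambda>n. {x \<in> \<Omega>. real (Suc n) * \<psi> x < C})"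
  have [measurable]: "\<psi> \<in> borel_measurable borel" "\<Omega> \<in> sets borel"
    using \<psi>(1) \<Omega>(1) by (auto intro: borel_measurable_continuous_onI)
  have meas: "A n \<in> sets lborel" for n unfolding A_def by measurable
  have "decseq A"
  proof (rule decseq_SucI)
    fix n
    have "real (Suc n) * \<psi> x \<le> real (Suc (Suc n)) * \<psi> x" if "x \<in> \<Omega>" for x
      using \<psi>(2)[OF that] by (intro mult_right_mono) auto
    then show "A (Suc n) \<subseteq> A n" unfolding A_def by force
  qed
  moreover have "emeasure lborel (A n) \<noteq> \<infinity>" for n
  proof -
    have "bounded (A n)" by (rule bounded_subset[OF \<Omega>(2)]) (auto simp: A_def)
    from emeasure_bounded_finite[OF this] show ?thesis by auto
  qed
  ultimately have "(\<lambda>n. emeasure lborel (A n)) \<longlonglongrightarrow> emeasure lborel (\<Inter>n. A n)"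
    using meas by (intro Lim_emeasure_decseq) auto
  moreover have "(\<Inter>n. A n) = {}"
  proof -
    have "\<exists>n. x \<notin> A n" for x
    proof (cases "x \<in> \<Omega>")
      case True
      obtain n where "C < real n * \<psi> x" using reals_Archimedean3[OF \<psi>(2)[OF True]] by blast
      also have "\<dots> \<le> real (Suc n) * \<psi> x" using \<psi>(2)[OF True] by (intro mult_right_mono) auto
      finally show ?thesis by (intro exI[of _ n]) (auto simp: A_def)
    qed (auto simp: A_def)
    then show ?thesis by blast
  qed
  ultimately have "(\<lambda>n. emeasure lborel (A n)) \<longlonglongrightarrow> 0" by simp
  moreover have "0 < ennreal \<delta>" using \<delta> by simp
  ultimately have "\<forall>\<^sub>F n in sequentially. emeasure lborel (A n) < ennreal \<delta>" by (rule order_tendstoD(2))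
  then obtain n where "emeasure lborel (A n) < ennreal \<delta>" by (auto simp: eventually_sequentially)
  then show ?thesis using meas[of n] by (intro exI[of _ "real (Suc n)"]) (auto simp: A_def)
qed

section \<open>The comparison principle\<close>

theorem corollary1p1:
  fixes s lam Lam \<mu> :: real
    and \<L> :: "(('a::euclidean_space \<Rightarrow> real) \<Rightarrow> 'a \<Rightarrow> real) set"
    and \<Omega> :: "'a set"
    and f u v :: "'a \<Rightarrow> real"
  assumes "0 < s" and "s < 1"
    and "0 < lam" and "lam \<le> Lam"
    and "\<L> \<subseteq> stable_class s lam Lam" and "\<L> \<noteq> {}"
    and "open \<Omega>" and "connected \<Omega>" and "\<Omega> \<noteq> {}" and "bounded \<Omega>" and "smooth_boundary \<Omega>"
    and "ereal \<mu> < principal_eigenvalue s \<L> \<Omega>"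
    and "continuous_on (closure \<Omega>) f"
    and "continuous_on UNIV u" and "u \<in> weighted_L1 s"
    and "continuous_on UNIV v" and "v \<in> weighted_L1 s"
    and "visc_ge \<L> \<Omega> u (\<lambda>x. f x - \<mu> * u x)"
    and "visc_le \<L> \<Omega> v (\<lambda>x. f x - \<mu> * v x)"
    and "\<forall>x\<in>- \<Omega>. u x \<le> v x"
  shows "\<forall>x. u x \<le> v x"
proof -
  note s = assms(1,2) and lam = assms(3,4) and L = assms(5,6) and \<Omega> = assms(7,10)
  note u = assms(14,15,18) and v = assms(16,17,19)
  obtain \<mu>' \<psi> where \<mu>': "\<mu> < \<mu>'"
    and \<psi>: "continuous_on UNIV \<psi>" "\<psi> \<in> weighted_L1 s" "visc_le \<L> \<Omega> \<psi> (\<lambda>x. - \<mu>' * \<psi> x)"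
    and \<psi>0: "\<And>x. 0 \<le> \<psi> x" and \<psi>pos: "\<And>x. x \<in> \<Omega> \<Longrightarrow> 0 < \<psi> x"
    using assms(12) unfolding principal_eigenvalue_def less_Sup_iff by auto
  define \<eta> where "\<eta> = \<mu>' - \<mu>"
  have \<eta>: "0 < \<eta>" using \<mu>' by (simp add: \<eta>_def)
  define w where "w = (\<lambda>x. u x - v x)"
  have w: "continuous_on UNIV w" unfolding w_def by (intro continuous_intros u v)
  have w_out: "w x \<le> 0" if "x \<notin> \<Omega>" for x using assms(20) that by (simp add: w_def)
  have z: "continuous_on UNIV (\<lambda>x. w x - t * \<psi> x)" "(\<lambda>x. w x - t * \<psi> x) \<in> weighted_L1 s" for t
    unfolding w_def using u v \<psi> by (auto intro!: continuous_intros weighted_L1_combination)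
  \<comment> \<open>At \<open>x\<close> the data \<open>f\<close> cancels and \<open>- \<mu> w + t \<mu>' \<psi> = t \<eta> \<psi> - \<mu> (w - t \<psi>)\<close>.\<close>
  have key: "\<exists>x\<in>\<Omega>. (\<forall>y. w y - t * \<psi> y \<le> w x - t * \<psi> x) \<and> (\<forall>R>0. t * \<eta> * \<psi> x - \<mu> * (w x - t * \<psi> x)
      \<le> lam * far_part s (\<lambda>_. 1) R (\<lambda>y. w y - t * \<psi> y) x)"
    if t: "0 < t" and above: "t * \<psi> x\<^sub>1 < w x\<^sub>1" for t x\<^sub>1
  proof -
    have f: "continuous_on \<Omega> f" using assms(13) by (rule continuous_on_subset) (rule closure_subset)
    have c: "continuous_on \<Omega> g" if "continuous_on UNIV g" for g :: "'a \<Rightarrow> real"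
      using that by (rule continuous_on_subset) simp
    have "\<exists>x\<in>\<Omega>. (\<forall>y. u y - v y - t * \<psi> y \<le> u x - v x - t * \<psi> x) \<and>
      (\<forall>R>0. (f x - \<mu> * u x) - (f x - \<mu> * v x) - t * (- \<mu>' * \<psi> x)
        \<le> lam * far_part s (\<lambda>_. 1) R (\<lambda>y. u y - v y - t * \<psi> y) x)"
    proof (rule comparison_at_maximum[OF s less_imp_le[OF lam(1)] lam(2) L \<Omega> u v \<psi> _ _ _ t])
      show "u x - v x - t * \<psi> x \<le> 0" if "x \<notin> \<Omega>" for x
        using w_out[OF that] mult_nonneg_nonneg[OF less_imp_le[OF t] \<psi>0[of x]] by (simp add: w_def)
      show "0 < u x\<^sub>1 - v x\<^sub>1 - t * \<psi> x\<^sub>1" using above by (simp add: w_def)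
    qed (intro continuous_intros f c u(1) v(1) \<psi>(1))+
    then show ?thesis by (simp add: w_def \<eta>_def algebra_simps)
  qed
  \<comment> \<open>For large \<open>t\<close> the set where \<open>w > t \<psi>\<close> is too small to contain a positive maximum of \<open>w - t \<psi>\<close>.\<close>
  have "\<exists>T>0. \<forall>x. w x \<le> T * \<psi> x"
  proof -
    define V where "V = unit_ball_vol (real DIM('a))"
    have V: "0 < V" by (simp add: V_def)
    let ?m = "\<lambda>r. V * r ^ DIM('a) / 2 / (2 * r) powr (real DIM('a) + 2 * s)"
    obtain r where r: "0 < r" "\<mu> / lam < ?m r" using annulus_mass_large[OF s(1) V] by blast
    have "compact (w ` closure \<Omega>)"
      using \<Omega>(2) by (intro compact_continuous_image continuous_on_subset[OF w]) auto
    then have "bdd_above (w ` closure \<Omega>)" by (intro bounded_imp_bdd_above compact_imp_bounded)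
    then obtain C where C: "\<And>x. x \<in> \<Omega> \<Longrightarrow> w x \<le> C"
      unfolding bdd_above_def using closure_subset by blast
    obtain t where t: "0 < t" and E: "{x \<in> \<Omega>. t * \<psi> x < C} \<in> sets lborel"
      "emeasure lborel {x \<in> \<Omega>. t * \<psi> x < C} \<le> ennreal (V * r ^ DIM('a) / 2)"
      using sublevel_measure_small[OF \<Omega> \<psi>(1) \<psi>pos, of "V * r ^ DIM('a) / 2" C] V r(1) by auto
    have "w x \<le> t * \<psi> x" for x
    proof (rule ccontr)
      assume "\<not> w x \<le> t * \<psi> x"
      then have above: "t * \<psi> x < w x" by simp
      from key[OF t this] obtain y where y: "y \<in> \<Omega>" "\<And>y'. w y' - t * \<psi> y' \<le> w y - t * \<psi> y"
        and ineq: "t * \<eta> * \<psi> y - \<mu> * (w y - t * \<psi> y) \<le> lam * far_part s (\<lambda>_. 1) r (\<lambda>y. w y - t * \<psi> y) y"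
        using r(1) by blast
      have M: "0 < w y - t * \<psi> y" using y(2)[of x] above by linarith
      have "far_part s (\<lambda>_. 1) r (\<lambda>y. w y - t * \<psi> y) y \<le> - ((w y - t * \<psi> y) * ?m r)"
        unfolding V_def
      proof (rule far_part_small_positivity_set[OF s(1) z y(2) r(1) E(1)])
        fix y' assume "0 < w y' - t * \<psi> y'"
        then have "t * \<psi> y' < w y'" by simp
        moreover have "0 \<le> t * \<psi> y'" using t \<psi>0[of y'] by simp
        ultimately show "y' \<in> {x \<in> \<Omega>. t * \<psi> x < C}"
          using w_out[of y'] C[of y'] by (cases "y' \<in> \<Omega>") auto
      qed (use E(2) M in \<open>auto simp: V_def\<close>)
      then have "t * \<eta> * \<psi> y - \<mu> * (w y - t * \<psi> y) \<le> lam * - ((w y - t * \<psi> y) * ?m r)"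
        using ineq lam(1) by (meson mult_left_mono less_imp_le order_trans)
      moreover have "\<mu> * (w y - t * \<psi> y) < lam * ((w y - t * \<psi> y) * ?m r)"
      proof -
        have "\<mu> < lam * ?m r" using r(2) lam(1) by (simp add: pos_divide_less_eq mult.commute)
        from mult_strict_right_mono[OF this M] show ?thesis
          by (simp only: mult.assoc mult.commute[of "?m r"])
      qed
      moreover have "0 \<le> t * \<eta> * \<psi> y" using t \<eta> \<psi>0[of y] by simp
      ultimately show False by (simp add: algebra_simps)
    qed
    with t show ?thesis by blast
  qed
  then obtain T where T: "0 < T" "\<And>x. w x \<le> T * \<psi> x" by blast
  \<comment> \<open>Any \<open>\<theta> < 1\<close> above \<open>\<bar>\<mu>\<bar> / (\<bar>\<mu>\<bar> + \<eta>)\<close> would do.\<close>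
  define \<theta> where "\<theta> = (\<bar>\<mu>\<bar> + \<eta> / 2) / (\<bar>\<mu>\<bar> + \<eta>)"
  have \<theta>: "0 < \<theta>" "\<theta> < 1" using \<eta> by (auto simp: \<theta>_def field_simps add_nonneg_pos)
  have \<theta>_gap: "\<bar>\<mu>\<bar> * (1 - \<theta>) < \<theta> * \<eta>"
  proof -
    have "\<theta> * (\<bar>\<mu>\<bar> + \<eta>) = \<bar>\<mu>\<bar> + \<eta> / 2" using \<eta> by (simp add: \<theta>_def)
    then show ?thesis using \<eta> by (simp add: algebra_simps)
  qed
  have shrink: "w x \<le> (\<theta> * T) * \<psi> x" if T: "0 < T" and below: "\<And>y. w y \<le> T * \<psi> y" for T x
  proof (rule ccontr)
    assume "\<not> w x \<le> \<theta> * T * \<psi> x"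
    then have above: "\<theta> * T * \<psi> x < w x" by simp
    define t where "t = \<theta> * T"
    have t: "0 < t" using \<theta> T by (simp add: t_def)
    from key[OF t, of x] above obtain y where y: "y \<in> \<Omega>" "\<And>y'. w y' - t * \<psi> y' \<le> w y - t * \<psi> y"
      and ineq: "t * \<eta> * \<psi> y - \<mu> * (w y - t * \<psi> y) \<le> lam * far_part s (\<lambda>_. 1) 1 (\<lambda>y. w y - t * \<psi> y) y"
      unfolding t_def using zero_less_one by blast
    have M: "0 < w y - t * \<psi> y" using y(2)[of x] above by (simp add: t_def)
    have "lam * far_part s (\<lambda>_. 1) 1 (\<lambda>y. w y - t * \<psi> y) y \<le> 0"
      using far_part_at_maximum(2)[OF y(2) s(1) z zero_less_one order_refl] lam(1)
      by (simp add: mult_nonneg_nonpos)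
    then have "t * \<eta> * \<psi> y \<le> \<mu> * (w y - t * \<psi> y)" using ineq by linarith
    also have "\<dots> \<le> \<bar>\<mu>\<bar> * (w y - t * \<psi> y)" using M by (intro mult_right_mono) auto
    \<comment> \<open>The maximum is now bounded by a multiple of \<open>\<psi>\<close> at the same point, so the factor \<open>\<psi> y > 0\<close>
      cancels, however small it is.\<close>
    also have "\<dots> \<le> \<bar>\<mu>\<bar> * (T * \<psi> y - t * \<psi> y)" using below[of y] by (intro mult_left_mono) auto
    finally have "(T * \<psi> y) * (\<theta> * \<eta>) \<le> (T * \<psi> y) * (\<bar>\<mu>\<bar> * (1 - \<theta>))"
      by (simp add: t_def algebra_simps)
    moreover have "0 < T * \<psi> y" using T \<psi>pos[OF y(1)] by simp
    ultimately show False using \<theta>_gap by (simp add: mult_le_cancel_left_pos)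
  qed
  have "w x \<le> \<theta> ^ n * T * \<psi> x" for n x
  proof (induction n arbitrary: x)
    case (Suc n)
    have "0 < \<theta> ^ n * T" using \<theta> T by simp
    from shrink[OF this Suc.IH] show ?case by (simp add: mult_ac)
  qed (use T in simp)
  moreover have "(\<lambda>n. \<theta> ^ n * T * \<psi> x) \<longlonglongrightarrow> 0 * T * \<psi> x" for x
    using \<theta> by (intro tendsto_intros LIMSEQ_realpow_zero) auto
  ultimately have "w x \<le> 0" for x
    using LIMSEQ_le_const[of "\<lambda>n. \<theta> ^ n * T * \<psi> x" 0 "w x"] by simp
  then show ?thesis by (simp add: w_def)
qed

end
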